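(* Let $n\in\mathbb{N}$, $0<r_j<\infty$, $1\le p_j<\infty$ and $1\le\theta_j\le\infty$ for $j=1,\ldots,n$. Let $$r=n\Big(\sum_{j=1}^n\frac1{r_j}\Big)^{-1},\quad p=\frac nr\Big(\sum_{j=1}^n\frac1{p_jr_j}\Big)^{-1},\quad \theta=\frac nr\Big(\sum_{j=1}^n\frac1{\theta_jr_j}\Big)^{-1},\quad \beta_j=\frac1{r_j}\Big(\frac rn+\frac1{p_j}-\frac1p\Big)$$ (with $1/\infty=0$, and $\theta=\infty$ if all $\theta_j=\infty$). Suppose that $\beta_j>0$ for $1\le j\le n$ and $p<\frac nr$, and put $q^*=np/(n-rp)$. Then there is a constant $c$, independent of $f$, such that for every locally integrable function $f$ on $\mathbb{R}^n$ with compact support $$\|f\|_{q^*,\theta}\le c\prod_{j=1}^n\Big[\|f\|_{b_{p_j,\theta_j;j}^{r_j}}\Big]^{\frac r{nr_j}}.$$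
   Context: For a measurable, almost everywhere finite function $f$ on $\mathbb{R}^n$ with $|\{x:|f(x)|>y\}|<\infty$ for every $y>0$, $f^*$ denotes the non-increasing rearrangement, $f^*(t)=\sup_{|E|=t}\inf_{x\in E}|f(x)|$, $0<t<\infty$. The Lorentz (quasi)norm is $\|f\|_{q,s}=\big(\int_0^\infty (t^{1/q}f^*(t))^s\,\frac{dt}{t}\big)^{1/s}$ for $0<q,s<\infty$, and $\|f\|_{q,\infty}=\sup_{t>0}t^{1/q}f^*(t)$. For $k\in\mathbb{N}$, $h\in\mathbb{R}$, $\Delta_j^k(h)f(x)=\sum_{i=0}^k(-1)^{k-i}\binom ki f(x+ihe_j)$, where $e_j$ is the $j$-th unit coordinate vector. For $r>0$, $1\le p<\infty$, $1\le\theta\le\infty$, $$\|f\|_{b_{p,\theta;j}^r}=\Big(\int_0^\infty[h^{-r}\|\Delta_j^k(h)f\|_p]^\theta\frac{dh}{h}\Big)^{1/\theta}$$ (essential supremum over $h>0$ of $h^{-r}\|\Delta_j^k(h)f\|_p$ if $\theta=\infty$), where $k>r$ is a fixed integer; different choices of $k>r$ give equivalent seminorms. The value may be $+\infty$. *)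

theory Defs
  imports "HOL-Analysis.Analysis" "HOL-Probability.Essential_Supremum"
begin

text \<open>All (quasi)norms take values in \<^typ>\<open>ennreal\<close>, so that the value \<open>\<infinity>\<close> is allowed.
  Every secondary exponent of type \<^typ>\<open>ennreal\<close> may be \<open>\<infinity>\<close>.\<close>

text \<open>Used with exponents \<open>a > 0\<close> only, so that \<open>0\<close> goes to \<open>0\<close> and \<open>\<infinity>\<close> goes to \<open>\<infinity>\<close>.\<close>

definition epowr :: "ennreal \<Rightarrow> real \<Rightarrow> ennreal" where
  "epowr x a = (if x = \<infinity> then \<infinity> else ennreal (enn2real x powr a))"

definition Lp_norm :: "real \<Rightarrow> ('a::euclidean_space \<Rightarrow> real) \<Rightarrow> ennreal" where
  "Lp_norm p f = epowr (\<integral>\<^sup>+x. epowr (ennreal \<bar>f x\<bar>) p \<partial>lebesgue) (1 / p)"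

definition rearrangement :: "('a::euclidean_space \<Rightarrow> real) \<Rightarrow> real \<Rightarrow> ennreal" where
  "rearrangement f t =
     (SUP E\<in>{E \<in> sets lebesgue. emeasure lebesgue E = ennreal t}. INF x\<in>E. ennreal \<bar>f x\<bar>)"

definition Lorentz_norm :: "real \<Rightarrow> ennreal \<Rightarrow> ('a::euclidean_space \<Rightarrow> real) \<Rightarrow> ennreal" where
  "Lorentz_norm q s f =
     (if s = \<infinity> then SUP t\<in>{0<..}. ennreal (t powr (1 / q)) * rearrangement f t
      else epowr (\<integral>\<^sup>+t\<in>{0<..}.
                    epowr (ennreal (t powr (1 / q)) * rearrangement f t) (enn2real s) * ennreal (1 / t)
                  \<partial>lebesgue) (1 / enn2real s))"

definition difference ::
  "'n::finite \<Rightarrow> nat \<Rightarrow> real \<Rightarrow> (real^'n \<Rightarrow> real) \<Rightarrow> real^'n \<Rightarrow> real" where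
  "difference j k h f x =
     (\<Sum>i\<le>k. (-1) ^ (k - i) * real (k choose i) * f (x + (real i * h) *\<^sub>R axis j 1))"

definition Besov_seminorm ::
  "'n::finite \<Rightarrow> nat \<Rightarrow> real \<Rightarrow> real \<Rightarrow> ennreal \<Rightarrow> (real^'n \<Rightarrow> real) \<Rightarrow> ennreal" where
  "Besov_seminorm j k r p \<theta> f =
     (if \<theta> = \<infinity>
      then esssup (restrict_space lebesgue {0<..})
             (\<lambda>h. ennreal (h powr (- r)) * Lp_norm p (difference j k h f))
      else epowr (\<integral>\<^sup>+h\<in>{0<..}.
                    epowr (ennreal (h powr (- r)) * Lp_norm p (difference j k h f)) (enn2real \<theta>)
                      * ennreal (1 / h)
                  \<partial>lebesgue) (1 / enn2real \<theta>))"

definition locally_integrable :: "('a::euclidean_space \<Rightarrow> real) \<Rightarrow> bool" where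
  "locally_integrable f \<longleftrightarrow> (\<forall>K. compact K \<longrightarrow> f absolutely_integrable_on K)"

text \<open>Functions that agree almost everywhere are identified, so the support is understood up to
  null sets; in particular compactness of the closure of \<open>{x. f x \<noteq> 0}\<close> suffices.\<close>

definition compactly_supported :: "('a::euclidean_space \<Rightarrow> real) \<Rightarrow> bool" where
  "compactly_supported f \<longleftrightarrow> (\<exists>K. compact K \<and> (AE x in lebesgue. x \<notin> K \<longrightarrow> f x = 0))"

end

theory Submission
  imports Defs
begin

text \<open>Let \<open>G(t)\<close> be the supremum of the averages of \<open>|f|\<close> over sets of measure at least \<open>t\<close>, a
  majorant of the rearrangement. Solving the \<open>k\<close>-th difference for \<open>f(x)\<close> in every coordinate direction
  and averaging the steps over a box with sides \<open>h\<^sub>1, \<dots>, h\<^sub>n\<close> gives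
  \<open>G(t) \<le> A (G(h\<^sub>1 \<cdots> h\<^sub>n) + \<Sum>\<^sub>j 2 t\<^sup>-\<^sup>1\<^sup>/\<^sup>p\<^sup>j \<phi>\<^sub>j(h\<^sub>j))\<close>, where \<open>\<phi>\<^sub>j(h)\<close> is the mean over \<open>0 < u < h\<close> of
  the \<open>L\<^sup>p\<^sup>j\<close> norm of the difference of step \<open>u\<close> in direction \<open>j\<close>.
  Each \<open>\<phi>\<^sub>j(h\<^sub>j)\<close> is at most \<open>h\<^sub>j\<close> to the power \<open>r\<^sub>j\<close> times \<open>\<Psi>\<^sub>j(ln h\<^sub>j)\<close>, where \<open>\<Psi>\<^sub>j\<close> is a smoothing
  on the logarithmic scale whose logarithm has a small Lipschitz constant. For \<open>t\<close> in a geometric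
  progression with ratio \<open>B\<close> one takes \<open>h\<^sub>1 \<cdots> h\<^sub>n = B t\<close> such that all terms of the sum are
  balanced; since \<open>\<beta>\<^sub>j > 0\<close>, every \<open>h\<^sub>j\<close> then grows at least geometrically in \<open>t\<close>, so the values of
  \<open>\<Psi>\<^sub>j\<close> along the progression are controlled by the \<open>j\<close>-th seminorm, and Hoelder's inequality with
  weights \<open>r / (n r\<^sub>j)\<close> applies. As \<open>B\<close> is large, the term \<open>G(B t)\<close> is absorbed.\<close>

section \<open>Balancing the side lengths\<close>

text \<open>Every absolute value comes from at most one nonnegative and one negative integer, so
  splitting by sign leaves two parts of a geometric series.\<close>

lemma sum_power_abs_int_le:
  fixes \<rho> :: real
  assumes "0 < \<rho>" "\<rho> < 1" "finite I"
  shows "(\<Sum>i\<in>I. \<rho> ^ nat \<bar>i\<bar>) \<le> 2 / (1 - \<rho>)"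
proof -
  have geo: "(\<Sum>k\<in>K. \<rho> ^ k) \<le> 1 / (1 - \<rho>)" if "finite K" for K
    using sum_le_suminf[of "\<lambda>k. \<rho> ^ k" K] that assms
    by (simp add: suminf_geometric summable_geometric)
  have part: "(\<Sum>i\<in>J. \<rho> ^ nat \<bar>i\<bar>) \<le> 1 / (1 - \<rho>)"
    if "finite J" "inj_on (\<lambda>i. nat \<bar>i\<bar>) J" for J :: "int set"
    using sum.reindex[OF that(2), of "\<lambda>k. \<rho> ^ k"] geo[of "(\<lambda>i. nat \<bar>i\<bar>) ` J"] that by simp
  have "(\<Sum>i\<in>I. \<rho> ^ nat \<bar>i\<bar>) = (\<Sum>i\<in>{i\<in>I. 0 \<le> i}. \<rho> ^ nat \<bar>i\<bar>) + (\<Sum>i\<in>{i\<in>I. i < 0}. \<rho> ^ nat \<bar>i\<bar>)"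
    using assms(3) by (subst sum.union_disjoint[symmetric]) (auto intro!: sum.cong)
  also have "\<dots> \<le> 1 / (1 - \<rho>) + 1 / (1 - \<rho>)"
    using assms(3) by (intro add_mono part) (auto simp: inj_on_def)
  finally show ?thesis by simp
qed

text \<open>Separated points, rounded in units of \<open>\<delta>\<close>, give distinct integers,
  so a two-sided geometric series dominates the sum. The factor
  \<open>exp (\<gamma> * \<delta>)\<close> pays for the rounding; the bound is the same for all
  \<open>u\<close>, \<open>v\<close> and \<open>F\<close>.\<close>

lemma sum_exp_separated_le:
  fixes v :: "int \<Rightarrow> real"
  assumes "0 < \<gamma>" "0 < \<delta>" and sep: "\<And>m m'. m < m' \<Longrightarrow> \<delta> \<le> v m' - v m" and "finite F"
  shows "(\<Sum>m\<in>F. exp (- \<gamma> * \<bar>u - v m\<bar>)) \<le> exp (\<gamma> * \<delta>) * (2 / (1 - exp (- \<gamma> * \<delta>)))"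
proof -
  define i where "i m = \<lfloor>(v m - u) / \<delta>\<rfloor>" for m
  have i_less: "i m < i m'" if "m < m'" for m m'
  proof -
    have "(v m - u) / \<delta> + 1 \<le> (v m' - u) / \<delta>"
      using divide_right_mono[OF sep[OF that], of \<delta>] \<open>0 < \<delta>\<close> by (simp add: diff_divide_distrib)
    then show ?thesis
      unfolding i_def by linarith
  qed
  have inj: "inj_on i F"
    by (rule linorder_inj_onI') (use i_less in \<open>force\<close>)
  have le: "exp (- \<gamma> * \<bar>u - v m\<bar>) \<le> exp (\<gamma> * \<delta>) * exp (- \<gamma> * \<delta>) ^ nat \<bar>i m\<bar>" for m
  proof -
    have "\<bar>real_of_int (i m)\<bar> \<le> \<bar>(v m - u) / \<delta>\<bar> + 1"
      unfolding i_def by linarith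
    then have "\<bar>real_of_int (i m)\<bar> * \<delta> \<le> (\<bar>(v m - u) / \<delta>\<bar> + 1) * \<delta>"
      using \<open>0 < \<delta>\<close> by (intro mult_right_mono) auto
    also have "\<dots> = \<bar>u - v m\<bar> + \<delta>"
      using \<open>0 < \<delta>\<close> by (simp add: abs_divide field_simps abs_minus_commute)
    finally have "\<gamma> * (\<bar>real_of_int (i m)\<bar> * \<delta>) \<le> \<gamma> * (\<bar>u - v m\<bar> + \<delta>)"
      using \<open>0 < \<gamma>\<close> by (intro mult_left_mono) auto
    then have "- \<gamma> * \<bar>u - v m\<bar> \<le> \<gamma> * \<delta> + real (nat \<bar>i m\<bar>) * (- \<gamma> * \<delta>)"
      by (simp add: algebra_simps)
    then show ?thesis
      by (simp flip: exp_of_nat_mult exp_add)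
  qed
  have "(\<Sum>m\<in>F. exp (- \<gamma> * \<bar>u - v m\<bar>)) \<le> exp (\<gamma> * \<delta>) * (\<Sum>m\<in>F. exp (- \<gamma> * \<delta>) ^ nat \<bar>i m\<bar>)"
    unfolding sum_distrib_left by (intro sum_mono le)
  also have "(\<Sum>m\<in>F. exp (- \<gamma> * \<delta>) ^ nat \<bar>i m\<bar>) = (\<Sum>i\<in>i ` F. exp (- \<gamma> * \<delta>) ^ nat \<bar>i\<bar>)"
    by (simp add: sum.reindex[OF inj])
  also have "\<dots> \<le> 2 / (1 - exp (- \<gamma> * \<delta>))"
    using assms by (intro sum_power_abs_int_le) auto
  finally show ?thesis by simp
qed

text \<open>The upper slope gives continuity and the lower slope makes the values unbounded in both
  directions; the intermediate value theorem does the rest.\<close>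

lemma surj_of_slope_bounds:
  fixes g :: "real \<Rightarrow> real"
  assumes "0 < a" and lo: "\<And>x y. x \<le> y \<Longrightarrow> a * (y - x) \<le> g y - g x"
    and up: "\<And>x y. x \<le> y \<Longrightarrow> g y - g x \<le> b * (y - x)"
  shows "\<exists>x. g x = y"
proof -
  have "\<bar>g x - g z\<bar> \<le> \<bar>b\<bar> * \<bar>x - z\<bar>" for x z
  proof (induction x z rule: linorder_wlog)
    case (le x z)
    have "b * (z - x) \<le> \<bar>b\<bar> * (z - x)"
      using le by (intro mult_right_mono) auto
    moreover have "0 \<le> a * (z - x)"
      using le \<open>0 < a\<close> by simp
    ultimately show ?case
      using lo[OF le] up[OF le] le by auto
  qed (simp add: abs_minus_commute)
  then have "\<bar>b\<bar>-lipschitz_on UNIV g"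
    by (intro lipschitz_onI) (auto simp: dist_real_def)
  then have cont: "continuous_on A g" for A
    using lipschitz_on_continuous_on continuous_on_subset by blast
  \<comment> \<open>At distance \<open>d\<close> from \<open>0\<close> the lower slope alone moves
    \<open>g\<close> by at least \<open>\<bar>y - g 0\<bar>\<close>.\<close>
  define d where "d = \<bar>y - g 0\<bar> / a"
  have "0 \<le> d" "a * d = \<bar>y - g 0\<bar>"
    using \<open>0 < a\<close> by (auto simp: d_def)
  then have "g (- d) \<le> y" "y \<le> g d"
    using lo[of "- d" 0] lo[of 0 d] by auto
  then show ?thesis
    using IVT'[of g "- d" y d] cont \<open>0 \<le> d\<close> by fastforce
qed

text \<open>Each \<open>G j\<close> is an increasing bijection. The sum of the inverses at
  \<open>l + c j\<close>, as a function of \<open>l\<close>, again has slopes between positive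
  bounds and so attains \<open>\<tau>\<close>. In the application the \<open>v j\<close> are
  logarithms of side lengths, and \<open>l\<close> is the part of the level shared by all
  directions.\<close>

lemma balance_exists:
  fixes G :: "'n::finite \<Rightarrow> real \<Rightarrow> real"
  assumes a: "\<And>j. 0 < a j" and lo: "\<And>j x y. x \<le> y \<Longrightarrow> a j * (y - x) \<le> G j y - G j x"
    and up: "\<And>j x y. x \<le> y \<Longrightarrow> G j y - G j x \<le> b j * (y - x)"
  shows "\<exists>l v. (\<forall>j. G j (v j) = l + c j) \<and> (\<Sum>j\<in>UNIV. v j) = (\<tau>::real)"
proof -
  have "\<exists>x. G j x = y" for j y
    using surj_of_slope_bounds[OF a lo up] .
  then obtain I where I: "\<And>j y. G j (I j y) = y"
    by metis
  have ab: "a j \<le> b j" for j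
    using lo[of 0 1 j] up[of 0 1 j] by simp
  then have b: "0 < b j" for j
    using a[of j] ab[of j] by linarith
  have mono: "I j x \<le> I j y" if "x \<le> y" for j x y
  proof (rule ccontr)
    assume "\<not> I j x \<le> I j y"
    then have "0 < a j * (I j x - I j y)" "a j * (I j x - I j y) \<le> x - y"
      using a[of j] lo[of "I j y" "I j x" j] by (auto simp: I)
    with that show False
      by simp
  qed
  have diff: "y - x \<le> b j * (I j y - I j x)" "a j * (I j y - I j x) \<le> y - x" if "x \<le> y" for j x y
    using up[OF mono[OF that], of j j] lo[OF mono[OF that], of j j] by (simp_all add: I)
  have "(\<Sum>j\<in>UNIV. 1 / b j) * (y - x) \<le> (\<Sum>j\<in>UNIV. I j (y + c j)) - (\<Sum>j\<in>UNIV. I j (x + c j))"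
    if "x \<le> y" for x y
    unfolding sum_distrib_right sum_subtractf[symmetric]
    using b diff(1)[OF add_right_mono[OF that]]
    by (intro sum_mono) (simp add: pos_divide_le_eq mult.commute)
  moreover have "(\<Sum>j\<in>UNIV. I j (y + c j)) - (\<Sum>j\<in>UNIV. I j (x + c j)) \<le> (\<Sum>j\<in>UNIV. 1 / a j) * (y - x)"
    if "x \<le> y" for x y
    unfolding sum_distrib_right sum_subtractf[symmetric]
    using a diff(2)[OF add_right_mono[OF that]]
    by (intro sum_mono) (simp add: pos_le_divide_eq mult.commute)
  moreover have "0 < (\<Sum>j\<in>UNIV. 1 / b j)"
    using b by (intro sum_pos) auto
  ultimately obtain l where "(\<Sum>j\<in>UNIV. I j (l + c j)) = \<tau>"
    using surj_of_slope_bounds[of "\<Sum>j\<in>UNIV. 1 / b j" "\<lambda>l. \<Sum>j\<in>UNIV. I j (l + c j)"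
        "\<Sum>j\<in>UNIV. 1 / a j" \<tau>] by blast
  then show ?thesis
    by (intro exI[of _ l] exI[of _ "\<lambda>j. I j (l + c j)"]) (simp add: I)
qed

text \<open>If the shared level dropped by more than \<open>\<eta> * (\<tau>' - \<tau>)\<close>, the
  increments of \<open>v\<close> would be too small to add up to \<open>\<tau>' - \<tau>\<close>.
  Hence each \<open>G j\<close> rises by at least half of \<open>(\<tau>' - \<tau>) * a j\<close>,
  and the upper slope turns this into growth of \<open>v j\<close>.\<close>

lemma balance_spread:
  fixes G :: "'n::finite \<Rightarrow> real \<Rightarrow> real"
  assumes r: "\<And>j. 0 < r j" and \<kappa>: "0 < \<kappa>" "\<kappa> < 1"
    and lo: "\<And>j x y. x \<le> y \<Longrightarrow> r j * (1 - \<kappa>) * (y - x) \<le> G j y - G j x"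
    and up: "\<And>j x y. x \<le> y \<Longrightarrow> G j y - G j x \<le> r j * (1 + \<kappa>) * (y - x)"
    and a: "\<And>j. 0 < a j" "(\<Sum>j\<in>UNIV. a j / r j) = 1"
    and \<eta>: "0 < \<eta>" "\<And>j. \<eta> \<le> a j / 2" "\<kappa> \<le> \<eta> * (\<Sum>j\<in>UNIV. 1 / r j)"
    and v: "\<And>j. G j (v j) = l + \<tau> * a j" "(\<Sum>j\<in>UNIV. v j) = \<tau>"
    and v': "\<And>j. G j (v' j) = l' + \<tau>' * a j" "(\<Sum>j\<in>UNIV. v' j) = \<tau>'"
    and less: "\<tau> < \<tau>'"
  shows "a j / (2 * r j * (1 + \<kappa>)) * (\<tau>' - \<tau>) \<le> v' j - v j"
proof -
  define D where "D = l' - l"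
  have G: "G j (v' j) - G j (v j) = D + (\<tau>' - \<tau>) * a j" for j
    by (simp add: v v' D_def algebra_simps)
  have D: "- \<eta> * (\<tau>' - \<tau>) \<le> D"
  proof (rule ccontr)
    assume D: "\<not> ?thesis"
    have bnd: "v' j - v j < (\<tau>' - \<tau>) * (a j - \<eta>) / (r j * (1 - \<kappa>))" for j
    \<comment> \<open>The lower slope is useful here only for an increasing coordinate. Otherwise
      positivity of the right-hand side suffices, which follows from
      \<open>\<eta> \<le> a j / 2\<close>.\<close>
    proof (cases "v' j \<le> v j")
      case True
      have "0 < (\<tau>' - \<tau>) * (a j - \<eta>) / (r j * (1 - \<kappa>))"
        using \<eta>(2)[of j] a(1)[of j] r[of j] \<kappa> less by (intro divide_pos_pos mult_pos_pos) auto
      then show ?thesis using True by linarith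
    next
      case False
      then have "r j * (1 - \<kappa>) * (v' j - v j) \<le> D + (\<tau>' - \<tau>) * a j"
        using lo[of "v j" "v' j" j] G[of j] by simp
      also have "\<dots> < (\<tau>' - \<tau>) * (a j - \<eta>)"
        using D by (simp add: algebra_simps)
      finally show ?thesis
        using r[of j] \<kappa> by (simp add: field_simps)
    qed
    have "\<tau>' - \<tau> = (\<Sum>j\<in>UNIV. v' j - v j)"
      by (simp add: sum_subtractf v v')
    also have "\<dots> < (\<Sum>j\<in>UNIV. (\<tau>' - \<tau>) * (a j - \<eta>) / (r j * (1 - \<kappa>)))"
      by (intro sum_strict_mono bnd) auto
    also have "\<dots> = (\<tau>' - \<tau>) / (1 - \<kappa>) * (\<Sum>j\<in>UNIV. a j / r j - \<eta> * (1 / r j))"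
      using \<kappa> r by (subst sum_distrib_left) (intro sum.cong, auto simp: field_simps less_imp_neq[symmetric])
    also have "\<dots> = (\<tau>' - \<tau>) / (1 - \<kappa>) * (1 - \<eta> * (\<Sum>j\<in>UNIV. 1 / r j))"
      by (simp add: sum_subtractf a sum_distrib_left)
    \<comment> \<open>By the condition linking \<open>\<kappa>\<close> and \<open>\<eta>\<close>,
      the assumed drop of the level outweighs the factor \<open>1 - \<kappa>\<close> lost in the
      lower slopes.\<close>
    also have "\<dots> \<le> (\<tau>' - \<tau>) / (1 - \<kappa>) * (1 - \<kappa>)"
      using less \<kappa> \<eta> by (intro mult_left_mono) auto
    also have "\<dots> = \<tau>' - \<tau>"
      using \<kappa> by simp
    finally show False by simp
  qed
  have "\<eta> * (\<tau>' - \<tau>) \<le> a j / 2 * (\<tau>' - \<tau>)"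
    using less \<eta>(2)[of j] by (intro mult_right_mono) auto
  then have half: "a j / 2 * (\<tau>' - \<tau>) \<le> G j (v' j) - G j (v j)"
    using D unfolding G by (simp add: field_simps)
  have "0 < a j / 2 * (\<tau>' - \<tau>)"
    using a(1)[of j] less by simp
  then have "v j \<le> v' j"
    using half lo[of "v' j" "v j" j] r[of j] \<kappa>
    by (smt (verit) mult_nonneg_nonneg mult_pos_pos)
  with half up[of "v j" "v' j" j] have "a j / 2 * (\<tau>' - \<tau>) \<le> r j * (1 + \<kappa>) * (v' j - v j)"
    by linarith
  then have "a j / 2 * (\<tau>' - \<tau>) / (r j * (1 + \<kappa>)) \<le> v' j - v j"
    using r[of j] \<kappa> by (simp add: pos_divide_le_eq mult.commute)
  then show ?thesis
    by (simp add: mult_ac)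
qed

section \<open>Averages and rearrangements\<close>

lemma epowr_ennreal [simp]: "0 \<le> x \<Longrightarrow> epowr (ennreal x) a = ennreal (x powr a)"
  by (simp add: epowr_def)

lemma epowr_top [simp]: "epowr top a = top"
  by (simp add: epowr_def)

lemma epowr_0 [simp]: "epowr 0 a = 0"
  by (simp add: epowr_def)

lemma borel_measurable_epowr [measurable]:
  assumes [measurable]: "f \<in> borel_measurable M"
  shows "(\<lambda>x. epowr (f x) a) \<in> borel_measurable M"
  unfolding epowr_def by measurable

lemma epowr_mono: "0 \<le> a \<Longrightarrow> x \<le> y \<Longrightarrow> epowr x a \<le> epowr y a"
  by (cases x; cases y) (auto intro!: ennreal_leI powr_mono2 simp: top_unique)

lemma epowr_epowr: "epowr (epowr x a) b = epowr x (a * b)"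
  by (cases x) (auto simp: powr_powr)

lemma epowr_one [simp]: "epowr x 1 = x"
  by (cases x) auto

lemma epowr_eq_0_iff [simp]: "epowr x a = 0 \<longleftrightarrow> x = 0"
  by (cases x) auto

text \<open>Serves as Young's inequality and includes \<open>p = 1\<close>: above the threshold
  \<open>a\<close> the factor \<open>(u / a) powr (p - 1)\<close> is at least 1. A suitable choice
  of \<open>a\<close> later gives Hoelder's inequality up to a constant.\<close>

lemma le_powr_add:
  fixes u a p :: real
  assumes "0 \<le> u" "0 < a" "1 \<le> p"
  shows "u \<le> a powr (1 - p) * u powr p + a"
proof (cases "u \<le> a")
  case False
  have "u = u powr (1 - p) * u powr p"
    using False assms by (simp flip: powr_add)
  also have "\<dots> \<le> a powr (1 - p) * u powr p"
    using False assms by (intro mult_right_mono powr_mono2') auto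
  finally show ?thesis
    using assms by simp
qed (use assms in \<open>simp add: add_increasing\<close>)

lemma le_epowr_add:
  assumes "0 < a" "1 \<le> p"
  shows "x \<le> ennreal (a powr (1 - p)) * epowr x p + ennreal a"
  using assms by (cases x) (auto simp: ennreal_mult_top le_powr_add simp flip: ennreal_mult ennreal_plus intro!: ennreal_leI)

lemma Lp_norm_lborel: "Lp_norm p f = epowr (\<integral>\<^sup>+x. epowr (ennreal \<bar>f x\<bar>) p \<partial>lborel) (1 / p)"
  by (simp add: Lp_norm_def nn_integral_completion)

lemma nn_integral_translate:
  fixes F :: "'a::euclidean_space \<Rightarrow> ennreal"
  assumes [measurable]: "F \<in> borel_measurable borel"
  shows "(\<integral>\<^sup>+x. F (x + a) \<partial>lborel) = (\<integral>\<^sup>+x. F x \<partial>lborel)"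
proof -
  have "(\<integral>\<^sup>+x. F x \<partial>lborel) = (\<integral>\<^sup>+x. F x \<partial>distr lborel borel ((+) a))"
    by (simp add: lborel_distr_plus)
  then show ?thesis
    by (simp add: nn_integral_distr add.commute)
qed

lemma Lp_norm_translate:
  fixes g :: "'a::euclidean_space \<Rightarrow> real"
  assumes [measurable]: "g \<in> borel_measurable borel"
  shows "Lp_norm p (\<lambda>x. g (x + a)) = Lp_norm p g"
  unfolding Lp_norm_lborel
  using nn_integral_translate[of "\<lambda>x. epowr (ennreal \<bar>g x\<bar>) p" a] by simp

text \<open>Hoelder's inequality against the indicator of \<open>S\<close>; the factor 2 comes from
  integrating the two-term bound \<open>le_epowr_add\<close>.\<close>

lemma set_nn_integral_le_Lp_norm:
  fixes g :: "'a::euclidean_space \<Rightarrow> real"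
  assumes [measurable]: "g \<in> borel_measurable borel" "S \<in> sets borel"
    and m: "emeasure lborel S = ennreal m" "0 < m" and p: "1 \<le> p"
  shows "(\<integral>\<^sup>+x\<in>S. ennreal \<bar>g x\<bar> \<partial>lborel) \<le> ennreal (2 * m powr (1 - 1 / p)) * Lp_norm p g"
proof (cases "(\<integral>\<^sup>+x. epowr (ennreal \<bar>g x\<bar>) p \<partial>lborel)")
  case top
  then show ?thesis
    using m by (simp add: Lp_norm_lborel ennreal_mult_top)
next
  case (real x)
  note [simp del] = epowr_ennreal
  show ?thesis
  proof (cases "x = 0")
    case True
    then have "(\<integral>\<^sup>+x. epowr (ennreal \<bar>g x\<bar>) p \<partial>lborel) = 0"
      using real by simp
    then have "AE x in lborel. epowr (ennreal \<bar>g x\<bar>) p = 0"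
      by (subst (asm) nn_integral_0_iff_AE) auto
    then have "(\<integral>\<^sup>+x\<in>S. ennreal \<bar>g x\<bar> \<partial>lborel) = (\<integral>\<^sup>+x. 0 \<partial>(lborel :: 'a measure))"
      by (intro nn_integral_cong_AE) auto
    then show ?thesis by simp
  next
    case False
    \<comment> \<open>This threshold makes the two integrated terms equal. It is positive because
      the case \<open>x = 0\<close> has been split off.\<close>
    define a where "a = (x / m) powr (1 / p)"
    have a: "0 < a" "a powr p = x / m"
      using False real m p by (auto simp: a_def powr_powr)
    have "(\<integral>\<^sup>+y\<in>S. ennreal \<bar>g y\<bar> \<partial>lborel)
        \<le> (\<integral>\<^sup>+y. ennreal (a powr (1 - p)) * epowr (ennreal \<bar>g y\<bar>) p + ennreal a * indicator S y \<partial>lborel)"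
      using le_epowr_add[OF a(1) p] by (intro nn_integral_mono) (auto simp: indicator_def)
    also have "\<dots> = ennreal (a powr (1 - p)) * ennreal x + ennreal a * ennreal m"
      using real m by (simp add: nn_integral_add nn_integral_cmult)
    also have "\<dots> = ennreal (a powr (1 - p) * x + a * m)"
      using real m a by (simp add: ennreal_mult)
    also have "a powr (1 - p) * x = a * m"
      using a False real m by (simp add: powr_diff)
    also have "a * m + a * m = 2 * m powr (1 - 1 / p) * x powr (1 / p)"
      using real m by (simp add: a_def powr_divide powr_diff)
    finally show ?thesis
      using real m by (simp add: Lp_norm_lborel epowr_ennreal ennreal_mult)
  qed
qed

definition avg_sup :: "('a::euclidean_space \<Rightarrow> real) \<Rightarrow> real \<Rightarrow> ennreal" where
  "avg_sup f t = (SUP S\<in>{S \<in> sets lborel. ennreal t \<le> emeasure lborel S \<and> emeasure lborel S < \<infinity>}.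
                   (\<integral>\<^sup>+x\<in>S. ennreal \<bar>f x\<bar> \<partial>lborel) / emeasure lborel S)"

lemma set_nn_integral_le_avg_sup:
  fixes f :: "'a::euclidean_space \<Rightarrow> real"
  assumes "S \<in> sets borel" "emeasure lborel S = ennreal m" "0 < m" "t \<le> m"
  shows "(\<integral>\<^sup>+x\<in>S. ennreal \<bar>f x\<bar> \<partial>lborel) \<le> ennreal m * avg_sup f t"
proof -
  have "(\<integral>\<^sup>+x\<in>S. ennreal \<bar>f x\<bar> \<partial>lborel) / emeasure lborel S \<le> avg_sup f t"
    unfolding avg_sup_def using assms by (intro SUP_upper) (auto intro: ennreal_leI)
  then have "(\<integral>\<^sup>+x\<in>S. ennreal \<bar>f x\<bar> \<partial>lborel) / ennreal m * ennreal m \<le> avg_sup f t * ennreal m"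
    using assms by (intro mult_right_mono) auto
  then show ?thesis
    using assms by (simp add: ennreal_divide_times divide_mult_eq mult.commute[of "avg_sup f t"] ennreal_mult_divide_eq)
qed

lemma avg_sup_antimono: "s \<le> t \<Longrightarrow> avg_sup f t \<le> avg_sup f s"
  unfolding avg_sup_def by (intro SUP_subset_mono) (auto intro: order_trans[OF ennreal_leI])

text \<open>For integrable \<open>f\<close> this decay makes the averages finite and provides the
  vanishing limit on which the absorption rests.\<close>

lemma avg_sup_le:
  fixes f :: "'a::euclidean_space \<Rightarrow> real"
  assumes "0 < t"
  shows "avg_sup f t \<le> (\<integral>\<^sup>+x. ennreal \<bar>f x\<bar> \<partial>lborel) / ennreal t"
  unfolding avg_sup_def
proof (intro SUP_least, safe)
  fix S :: "'a set" assume S: "ennreal t \<le> emeasure lborel S" "emeasure lborel S < \<infinity>"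
  then obtain m where m: "emeasure lborel S = ennreal m" "0 \<le> m"
    by (cases "emeasure lborel S") auto
  then have "inverse (emeasure lborel S) \<le> inverse (ennreal t)"
    using S assms by (auto simp: inverse_ennreal intro!: ennreal_leI)
  then have "(\<integral>\<^sup>+x\<in>S. ennreal \<bar>f x\<bar> \<partial>lborel) / emeasure lborel S
     \<le> (\<integral>\<^sup>+x\<in>S. ennreal \<bar>f x\<bar> \<partial>lborel) / ennreal t"
    unfolding divide_ennreal_def by (intro mult_left_mono) auto
  also have "\<dots> \<le> (\<integral>\<^sup>+x. ennreal \<bar>f x\<bar> \<partial>lborel) / ennreal t"
    by (intro divide_right_mono_ennreal nn_integral_mono) (auto simp: indicator_def)
  finally show "(\<integral>\<^sup>+x\<in>S. ennreal \<bar>f x\<bar> \<partial>lborel) / emeasure lborel S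
     \<le> (\<integral>\<^sup>+x. ennreal \<bar>f x\<bar> \<partial>lborel) / ennreal t" .
qed

text \<open>The infimum over a set is at most the average over any part of it of positive finite
  measure. Replacing \<open>f\<close> by a Borel representative \<open>g\<close> costs a null
  set.\<close>

lemma rearrangement_le_avg_sup:
  fixes f g :: "'a::euclidean_space \<Rightarrow> real"
  assumes ae: "AE x in lebesgue. f x = g x" and t: "0 < t"
  shows "rearrangement f t \<le> avg_sup g t"
  unfolding rearrangement_def
proof (intro SUP_least, safe)
  fix E :: "'a set" assume E: "E \<in> sets lebesgue" "emeasure lebesgue E = ennreal t"
  obtain N where N: "N \<in> null_sets lborel" "{x. f x \<noteq> g x} \<subseteq> N"
    using ae by (subst (asm) AE_completion_iff) (auto simp: eventually_ae_filter)
  \<comment> \<open>\<open>E\<close> is only Lebesgue measurable. Its Borel main part, without a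
    null set that contains all points where \<open>f\<close> and \<open>g\<close> differ, still has
    measure \<open>t\<close>.\<close>
  define S where "S = main_part lborel E - N"
  have S [measurable]: "S \<in> sets borel"
    using E N main_part_sets[OF E(1)] by (auto simp: S_def)
  have S_E: "S \<subseteq> E"
    unfolding S_def using main_part_null_part_Un[OF E(1)] by blast
  have mS: "emeasure lborel S = ennreal t"
    using E N main_part_sets[OF E(1)] by (simp add: S_def emeasure_Diff_null_set)
  define I where "I = (INF x\<in>E. ennreal \<bar>f x\<bar>)"
  have "I * indicator S x \<le> ennreal \<bar>g x\<bar> * indicator S x" for x
  proof (cases "x \<in> S")
    case True
    then have "f x = g x" "x \<in> E"
      using N(2) S_E by (auto simp: S_def)
    then show ?thesis
      unfolding I_def using INF_lower[of x E "\<lambda>x. ennreal \<bar>f x\<bar>"] True by simp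
  qed simp
  then have "(\<integral>\<^sup>+x. I * indicator S x \<partial>lborel) \<le> (\<integral>\<^sup>+x\<in>S. ennreal \<bar>g x\<bar> \<partial>lborel)"
    by (intro nn_integral_mono)
  then have "I * ennreal t \<le> (\<integral>\<^sup>+x\<in>S. ennreal \<bar>g x\<bar> \<partial>lborel)"
    by (simp add: nn_integral_cmult_indicator mS)
  also have "\<dots> \<le> ennreal t * avg_sup g t"
    using S mS t by (intro set_nn_integral_le_avg_sup) auto
  finally have "ennreal t * I \<le> ennreal t * avg_sup g t"
    by (simp add: mult.commute)
  then show "I \<le> avg_sup g t"
    using t by (subst (asm) ennreal_mult_le_mult_iff) auto
qed

section \<open>Estimate by differences\<close>

definition scale_shift :: "('n \<Rightarrow> real) \<Rightarrow> real^'n \<Rightarrow> real^'n" where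
  "scale_shift c y = (\<chi> j. c j * y $ j)"

lemma scale_shift_nth [simp]: "scale_shift c y $ j = c j * y $ j"
  by (simp add: scale_shift_def)

lemma scale_shift_measurable [measurable]:
  "scale_shift c \<in> borel_measurable borel"
  unfolding scale_shift_def
  by (intro borel_measurable_continuous_onI continuous_intros)

lemma vec_nth_measurable [measurable]: "(\<lambda>x::real^'n. x $ j) \<in> borel_measurable borel"
  by (intro borel_measurable_continuous_onI continuous_intros)

definition corner_box :: "('n::finite \<Rightarrow> real) \<Rightarrow> (real^'n) set" where
  "corner_box h = {y. \<forall>j. 0 < y $ j \<and> y $ j < h j}"

lemma corner_box_eq: "corner_box h = box 0 (\<chi> j. h j)"
  by (auto simp: corner_box_def mem_box_cart)

lemma corner_box_measurable [measurable]: "corner_box h \<in> sets borel"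
  by (simp add: corner_box_eq)

lemma indicator_corner_box:
  "(indicator (corner_box h) y :: ennreal) = (\<Prod>j\<in>UNIV. indicator {0<..<h j} (y $ j))"
  by (auto simp: corner_box_def indicator_def prod_zero_iff split: if_splits)

text \<open>The bijection from coordinates to \<open>Basis\<close> vectors carries over the product
  formula for \<open>lborel\<close>.\<close>

lemma nn_integral_vec_prod:
  fixes F :: "'n::finite \<Rightarrow> real \<Rightarrow> ennreal"
  assumes "\<And>j. F j \<in> borel_measurable borel"
  shows "(\<integral>\<^sup>+y. (\<Prod>j\<in>UNIV. F j (y $ j)) \<partial>(lborel :: (real^'n) measure)) = (\<Prod>j\<in>UNIV. \<integral>\<^sup>+u. F j u \<partial>lborel)"
proof -
  have inj: "inj (\<lambda>j::'n. axis j (1::real))"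
    by (auto simp: inj_on_def axis_eq_axis)
  have B: "(Basis :: (real^'n) set) = range (\<lambda>j. axis j 1)"
    by (auto simp: Basis_vec_def)
  define f where "f b = F (inv (\<lambda>j::'n. axis j (1::real)) b)" for b
  have f: "f (axis j 1) = F j" for j
    by (simp add: f_def inv_f_f[OF inj])
  have "(\<integral>\<^sup>+y. (\<Prod>b\<in>Basis. f b (y \<bullet> b)) \<partial>(lborel :: (real^'n) measure)) = (\<Prod>b\<in>Basis. \<integral>\<^sup>+u. f b u \<partial>lborel)"
    using assms by (intro nn_integral_lborel_prod) (auto simp: B f)
  then show ?thesis
    by (simp add: B prod.reindex[OF inj] f inner_axis)
qed

text \<open>Every coordinate other than \<open>j\<close> is integrated out and contributes its side
  length.\<close>

lemma nn_integral_corner_box: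
  assumes [measurable]: "F \<in> borel_measurable borel" and h: "\<And>j. 0 < h j"
  shows "(\<integral>\<^sup>+y\<in>corner_box h. F (y $ j) \<partial>lborel)
    = ennreal ((\<Prod>i\<in>UNIV. h i) / h j) * (\<integral>\<^sup>+u\<in>{0<..<h j}. F u \<partial>lborel)"
proof -
  define G where "G i u = (if i = j then F u else 1) * indicator {0<..<h i} u" for i u
  have [measurable]: "G i \<in> borel_measurable borel" for i
    unfolding G_def by measurable
  have "(\<integral>\<^sup>+y\<in>corner_box h. F (y $ j) \<partial>lborel) = (\<integral>\<^sup>+y. (\<Prod>i\<in>UNIV. G i (y $ i)) \<partial>lborel)"
    by (simp add: G_def prod.distrib indicator_corner_box prod.delta)
  also have "\<dots> = (\<Prod>i\<in>UNIV. \<integral>\<^sup>+u. G i u \<partial>lborel)"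
    by (rule nn_integral_vec_prod) simp
  also have "\<dots> = (\<integral>\<^sup>+u. G j u \<partial>lborel) * (\<Prod>i\<in>UNIV - {j}. \<integral>\<^sup>+u. G i u \<partial>lborel)"
    by (subst prod.remove[of _ j]) auto
  also have "(\<Prod>i\<in>UNIV - {j}. \<integral>\<^sup>+u. G i u \<partial>lborel) = (\<Prod>i\<in>UNIV - {j}. ennreal (h i))"
    by (intro prod.cong) (auto simp: G_def less_imp_le[OF h])
  also have "\<dots> = ennreal ((\<Prod>i\<in>UNIV. h i) / h j)"
    using h less_imp_neq[OF h[of j]] by (subst prod_ennreal) (auto simp: less_imp_le prod.remove[of UNIV j])
  finally show ?thesis
    by (simp add: G_def mult.commute)
qed

lemma emeasure_corner_box:
  assumes "\<And>j. 0 < h j"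
  shows "emeasure lborel (corner_box h) = ennreal (\<Prod>i\<in>UNIV. h i)"
proof -
  have "emeasure lborel (corner_box h) = (\<integral>\<^sup>+y. indicator (corner_box h) y \<partial>lborel)"
    by simp
  also have "\<dots> = (\<integral>\<^sup>+y. (\<Prod>i\<in>UNIV. indicator {0<..<h i} (y $ i)) \<partial>lborel)"
    by (simp add: indicator_corner_box)
  also have "\<dots> = (\<Prod>i\<in>UNIV. \<integral>\<^sup>+u. indicator {0<..<h i} u \<partial>lborel)"
    by (rule nn_integral_vec_prod) simp
  also have "\<dots> = ennreal (\<Prod>i\<in>UNIV. h i)"
    using assms by (simp add: prod_ennreal less_imp_le)
  finally show ?thesis .
qed

lemma nn_integral_scale_shift:
  fixes F :: "real^'n \<Rightarrow> ennreal"
  assumes [measurable]: "F \<in> borel_measurable borel" and c: "\<And>j. 0 < c j"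
  shows "(\<integral>\<^sup>+z. F z \<partial>lborel) = ennreal (\<Prod>j\<in>UNIV. c j) * (\<integral>\<^sup>+y. F (x + scale_shift c y) \<partial>lborel)"
proof -
  have inj: "inj (\<lambda>j::'n. axis j (1::real))"
    by (auto simp: inj_on_def axis_eq_axis)
  have B: "(Basis :: (real^'n) set) = range (\<lambda>j. axis j 1)"
    by (auto simp: Basis_vec_def)
  define c' where "c' b = c (inv (\<lambda>j::'n. axis j (1::real)) b)" for b
  have c': "c' (axis j 1) = c j" for j
    by (simp add: c'_def inv_f_f[OF inj])
  have T: "(\<Sum>b\<in>Basis. (c' b * (y \<bullet> b)) *\<^sub>R b) = scale_shift c y" for y :: "real^'n"
  proof -
    have "(\<Sum>b\<in>Basis. (c' b * (y \<bullet> b)) *\<^sub>R b) = (\<Sum>j\<in>UNIV. (c j * y $ j) *\<^sub>R axis j 1)"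
      by (simp add: B sum.reindex[OF inj] c' inner_axis)
    then show ?thesis
      by (simp add: vec_eq_iff axis_def if_distrib cong: if_cong)
  qed
  have P: "(\<Prod>b\<in>(Basis :: (real^'n) set). \<bar>c' b\<bar>) = (\<Prod>j\<in>UNIV. c j)"
    using c by (simp add: B prod.reindex[OF inj] c' less_imp_le)
  have "lborel = density (distr lborel borel (\<lambda>y. x + scale_shift c y)) (\<lambda>_. ennreal (\<Prod>j\<in>UNIV. c j))"
    unfolding T[symmetric] P[symmetric]
    by (rule lborel_affine_euclidean) (use c in \<open>auto simp: B c' less_imp_neq[symmetric]\<close>)
  then have "(\<integral>\<^sup>+z. F z \<partial>lborel)
      = (\<integral>\<^sup>+z. F z \<partial>density (distr lborel borel (\<lambda>y. x + scale_shift c y)) (\<lambda>_. ennreal (\<Prod>j\<in>UNIV. c j)))"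
    by simp
  then show ?thesis
    by (simp add: nn_integral_density nn_integral_distr nn_integral_cmult)
qed

lemma nn_integral_corner_box_le_avg_sup:
  fixes f :: "real^'n \<Rightarrow> real"
  assumes [measurable]: "f \<in> borel_measurable borel" and h: "\<And>j. 0 < h j" and c: "\<And>j. 1 \<le> c j"
  shows "(\<integral>\<^sup>+y\<in>corner_box h. ennreal \<bar>f (x + scale_shift c y)\<bar> \<partial>lborel)
    \<le> ennreal (\<Prod>j\<in>UNIV. h j) * avg_sup f (\<Prod>j\<in>UNIV. h j)"
proof -
  define V where "V = (\<Prod>j\<in>UNIV. h j)"
  define C where "C = (\<Prod>j\<in>UNIV. c j)"
  have c0: "0 < c j" for j
    using c[of j] by simp
  have V: "0 < V" and C: "1 \<le> C"
    using h c by (auto simp: V_def C_def intro!: prod_pos prod_ge_1)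
  define S where "S = (\<lambda>z. z - x) -` corner_box (\<lambda>j. c j * h j)"
  have [measurable]: "S \<in> sets borel"
    unfolding S_def by (rule measurable_sets_borel[of _ borel]) auto
  have S: "x + scale_shift c y \<in> S \<longleftrightarrow> y \<in> corner_box h" for y
    using c0 by (auto simp: S_def corner_box_def zero_less_mult_iff not_less dest: less_asym)
  have mS: "emeasure lborel S = ennreal (C * V)"
  proof -
    have "emeasure lborel S = (\<integral>\<^sup>+z. indicator S z \<partial>lborel)"
      by simp
    also have "\<dots> = ennreal C * (\<integral>\<^sup>+y. indicator S (x + scale_shift c y) \<partial>lborel)"
      unfolding C_def by (rule nn_integral_scale_shift) (auto simp: c0)
    also have "(\<lambda>y. indicator S (x + scale_shift c y) :: ennreal) = indicator (corner_box h)"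
      by (auto simp: indicator_def S)
    finally show ?thesis
      using V C h by (simp add: emeasure_corner_box V_def ennreal_mult)
  qed
  have "ennreal C * (\<integral>\<^sup>+y\<in>corner_box h. ennreal \<bar>f (x + scale_shift c y)\<bar> \<partial>lborel)
      = (\<integral>\<^sup>+z\<in>S. ennreal \<bar>f z\<bar> \<partial>lborel)"
    using c0 by (subst nn_integral_scale_shift[where c=c and x=x]) (auto simp: C_def S indicator_def)
  also have "\<dots> \<le> ennreal (C * V) * avg_sup f V"
    using V C by (intro set_nn_integral_le_avg_sup mS) auto
  also have "\<dots> = ennreal C * (ennreal V * avg_sup f V)"
    using V C by (simp add: ennreal_mult mult.assoc)
  finally show ?thesis
    using C unfolding V_def[symmetric] by (subst (asm) ennreal_mult_le_mult_iff) auto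
qed

section \<open>Elimination of the coordinate directions by differences\<close>

lemma difference_measurable [measurable]:
  assumes [measurable]: "f \<in> borel_measurable borel" "g \<in> borel_measurable M" "h \<in> borel_measurable M"
  shows "(\<lambda>x. difference j k (g x) f (h x)) \<in> borel_measurable M"
  unfolding difference_def by measurable

lemma Lp_norm_difference_measurable [measurable]:
  assumes [measurable]: "f \<in> borel_measurable borel"
  shows "(\<lambda>u. Lp_norm p (difference j k u f)) \<in> borel_measurable borel"
  unfolding Lp_norm_lborel by measurable

text \<open>The term \<open>i = 0\<close> of the difference is \<open>f z\<close> up to sign; the
  other terms are moved to the right-hand side.\<close>

lemma abs_le_difference:
  "\<bar>f z\<bar> \<le> (\<Sum>i\<in>{1..k}. real (k choose i) * \<bar>f (z + (real i * u) *\<^sub>R axis j 1)\<bar>) + \<bar>difference j k u f z\<bar>"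
proof -
  let ?t = "\<lambda>i. (- 1) ^ (k - i) * real (k choose i) * f (z + (real i * u) *\<^sub>R axis j 1)"
  have "difference j k u f z = ?t 0 + (\<Sum>i\<in>{1..k}. ?t i)"
    unfolding difference_def atMost_atLeast0 by (simp add: sum.atLeast_Suc_atMost)
  then have "\<bar>?t 0\<bar> \<le> \<bar>\<Sum>i\<in>{1..k}. ?t i\<bar> + \<bar>difference j k u f z\<bar>"
    by linarith
  also have "\<bar>\<Sum>i\<in>{1..k}. ?t i\<bar> \<le> (\<Sum>i\<in>{1..k}. \<bar>?t i\<bar>)"
    by (rule sum_abs)
  finally show ?thesis
    by (simp add: abs_mult power_abs)
qed

lemma nn_abs_le_difference:
  "ennreal \<bar>f z\<bar> \<le> (\<Sum>i\<in>{1..k}. ennreal (real (k choose i)) * ennreal \<bar>f (z + (real i * u) *\<^sub>R axis j 1)\<bar>)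
     + ennreal \<bar>difference j k u f z\<bar>"
proof -
  have "ennreal \<bar>f z\<bar> \<le> ennreal ((\<Sum>i\<in>{1..k}. real (k choose i) * \<bar>f (z + (real i * u) *\<^sub>R axis j 1)\<bar>)
      + \<bar>difference j k u f z\<bar>)"
    by (intro ennreal_leI abs_le_difference)
  also have "\<dots> = (\<Sum>i\<in>{1..k}. ennreal (real (k choose i)) * ennreal \<bar>f (z + (real i * u) *\<^sub>R axis j 1)\<bar>)
     + ennreal \<bar>difference j k u f z\<bar>"
    by (simp add: sum_nonneg ennreal_mult flip: sum_ennreal)
  finally show ?thesis .
qed

lemma scale_shift_fun_upd:
  "c j = 0 \<Longrightarrow> scale_shift (c(j := a)) y = scale_shift c y + (a * y $ j) *\<^sub>R axis j 1"
  by (auto simp: vec_eq_iff axis_def)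

lemma sum_binomial_le: "(\<Sum>i\<in>{1..k}. ennreal (real (k choose i))) \<le> ennreal (2 ^ k)"
proof -
  have "(\<Sum>i\<in>{1..k}. k choose i) \<le> (\<Sum>i\<le>k. k choose i)"
    by (intro sum_mono2) auto
  then have "real (\<Sum>i\<in>{1..k}. k choose i) \<le> real (2 ^ k)"
    unfolding choose_row_sum of_nat_le_iff .
  then show ?thesis
    by (simp add: sum_ennreal ennreal_leI flip: of_nat_sum)
qed

text \<open>Induction over the set \<open>J\<close> of directions still to be treated. Expanding
  \<open>f\<close> by the difference of step \<open>y $ j\<close> turns \<open>c j = 0\<close> into
  some \<open>i \<ge> 1\<close>, with an error \<open>e j\<close>. Once all coefficients are at
  least 1, the box averages are controlled by \<open>avg_sup\<close>. Since every expansion changes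
  \<open>c\<close>, it stays arbitrary in the induction.\<close>

lemma box_average_le:
  fixes f :: "real^'n \<Rightarrow> real" and h :: "'n \<Rightarrow> real" and k :: "'n \<Rightarrow> nat"
  assumes [measurable]: "f \<in> borel_measurable borel" "S \<in> sets borel"
    and m: "emeasure lborel S = ennreal m" "0 < m"
    and p: "\<And>j. 1 \<le> p j" and h: "\<And>j. 0 < h j"
    and c: "\<And>j. j \<in> J \<Longrightarrow> c j = 0" "\<And>j. j \<notin> J \<Longrightarrow> 1 \<le> c j"
  defines "V \<equiv> \<Prod>j\<in>UNIV. h j"
  defines "e j \<equiv> ennreal (2 * m powr (1 - 1 / p j)) *
             (\<integral>\<^sup>+y\<in>corner_box h. Lp_norm (p j) (difference j (k j) (y $ j) f) \<partial>lborel)"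
  shows "(\<integral>\<^sup>+y\<in>corner_box h. (\<integral>\<^sup>+x\<in>S. ennreal \<bar>f (x + scale_shift c y)\<bar> \<partial>lborel) \<partial>lborel)
    \<le> ennreal (\<Prod>j\<in>J. 2 ^ k j) * (ennreal (m * V) * avg_sup f V + (\<Sum>j\<in>J. e j))"
proof -
  have "finite J" by simp
  then show ?thesis using c
  proof (induction J arbitrary: c rule: finite_induct)
    case empty
    have V: "0 < V"
      unfolding V_def using h by (intro prod_pos) auto
    have "(\<integral>\<^sup>+y\<in>corner_box h. (\<integral>\<^sup>+x\<in>S. ennreal \<bar>f (x + scale_shift c y)\<bar> \<partial>lborel) \<partial>lborel)
       = (\<integral>\<^sup>+y. (\<integral>\<^sup>+x. ennreal \<bar>f (x + scale_shift c y)\<bar> * indicator S x * indicator (corner_box h) y \<partial>lborel) \<partial>lborel)"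
      by (simp add: nn_integral_multc)
    \<comment> \<open>The exchange puts the integral over \<open>y\<close> inside, so that the box
      estimate applies for each fixed \<open>x\<close>.\<close>
    also have "\<dots> = (\<integral>\<^sup>+x. (\<integral>\<^sup>+y. ennreal \<bar>f (x + scale_shift c y)\<bar> * indicator S x * indicator (corner_box h) y \<partial>lborel) \<partial>lborel)"
      by (intro lborel_pair.Fubini') measurable
    also have "\<dots> = (\<integral>\<^sup>+x\<in>S. (\<integral>\<^sup>+y\<in>corner_box h. ennreal \<bar>f (x + scale_shift c y)\<bar> \<partial>lborel) \<partial>lborel)"
      by (simp add: mult_ac flip: nn_integral_cmult)
    also have "\<dots> \<le> (\<integral>\<^sup>+x\<in>S. (ennreal V * avg_sup f V) \<partial>lborel)"
      unfolding V_def using h empty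
      by (intro nn_integral_mono mult_right_mono nn_integral_corner_box_le_avg_sup) auto
    also have "\<dots> = ennreal V * avg_sup f V * ennreal m"
      using m by (subst nn_integral_cmult_indicator) auto
    also have "\<dots> = ennreal (m * V) * avg_sup f V"
      using m V by (simp add: ennreal_mult mult_ac)
    finally show ?case by simp
  next
    case (insert j J)
    let ?E = "ennreal (m * V) * avg_sup f V + (\<Sum>j\<in>J. e j)"
    let ?P = "ennreal (\<Prod>j\<in>J. 2 ^ k j)"
    let ?I = "\<lambda>c y. \<integral>\<^sup>+x\<in>S. ennreal \<bar>f (x + scale_shift c y)\<bar> \<partial>lborel"
    let ?d = "\<lambda>y. ennreal (2 * m powr (1 - 1 / p j)) * Lp_norm (p j) (difference j (k j) (y $ j) f)"
    have cj: "c j = 0"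
      using insert.prems by simp
    have "?I c y \<le> (\<Sum>i\<in>{1..k j}. ennreal (real (k j choose i)) * ?I (c(j := real i)) y) + ?d y" for y
    proof -
      let ?D = "difference j (k j) (y $ j) f"
      have "?I c y \<le> (\<integral>\<^sup>+x. (\<Sum>i\<in>{1..k j}. ennreal (real (k j choose i)) *
            (ennreal \<bar>f (x + scale_shift (c(j := real i)) y)\<bar> * indicator S x))
          + ennreal \<bar>?D (x + scale_shift c y)\<bar> * indicator S x \<partial>lborel)"
      proof (intro nn_integral_mono)
        fix x
        have "ennreal \<bar>f (x + scale_shift c y)\<bar> * indicator S x
          \<le> ((\<Sum>i\<in>{1..k j}. ennreal (real (k j choose i)) * ennreal \<bar>f (x + scale_shift c y + (real i * y $ j) *\<^sub>R axis j 1)\<bar>)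
          + ennreal \<bar>?D (x + scale_shift c y)\<bar>) * indicator S x"
          by (intro mult_right_mono nn_abs_le_difference) auto
        then show "ennreal \<bar>f (x + scale_shift c y)\<bar> * indicator S x
          \<le> (\<Sum>i\<in>{1..k j}. ennreal (real (k j choose i)) *
            (ennreal \<bar>f (x + scale_shift (c(j := real i)) y)\<bar> * indicator S x))
          + ennreal \<bar>?D (x + scale_shift c y)\<bar> * indicator S x"
          by (simp add: scale_shift_fun_upd[of c, OF cj] distrib_right sum_distrib_right mult.assoc add.assoc)
      qed
      also have "\<dots> = (\<Sum>i\<in>{1..k j}. ennreal (real (k j choose i)) * ?I (c(j := real i)) y)
          + (\<integral>\<^sup>+x\<in>S. ennreal \<bar>?D (x + scale_shift c y)\<bar> \<partial>lborel)"
        by (subst nn_integral_add) (auto simp: nn_integral_sum nn_integral_cmult)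
      \<comment> \<open>Hoelder's inequality on \<open>S\<close> and then translation invariance
        remove the coefficients \<open>c\<close> from the error.\<close>
      also have "(\<integral>\<^sup>+x\<in>S. ennreal \<bar>?D (x + scale_shift c y)\<bar> \<partial>lborel)
          \<le> ennreal (2 * m powr (1 - 1 / p j)) * Lp_norm (p j) (\<lambda>x. ?D (x + scale_shift c y))"
        using m p by (intro set_nn_integral_le_Lp_norm) auto
      also have "Lp_norm (p j) (\<lambda>x. ?D (x + scale_shift c y)) = Lp_norm (p j) ?D"
        by (rule Lp_norm_translate) measurable
      finally show ?thesis
        by (simp only: add_left_mono)
    qed
    then have "(\<integral>\<^sup>+y\<in>corner_box h. ?I c y \<partial>lborel) \<le> (\<integral>\<^sup>+y\<in>corner_box h.
         (\<Sum>i\<in>{1..k j}. ennreal (real (k j choose i)) * ?I (c(j := real i)) y) + ?d y \<partial>lborel)"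
      by (intro nn_integral_mono mult_right_mono) auto
    also have "\<dots> = (\<integral>\<^sup>+y. (\<Sum>i\<in>{1..k j}. ennreal (real (k j choose i)) * (?I (c(j := real i)) y * indicator (corner_box h) y))
           + ennreal (2 * m powr (1 - 1 / p j)) * (Lp_norm (p j) (difference j (k j) (y $ j) f) * indicator (corner_box h) y) \<partial>lborel)"
      by (simp add: distrib_right sum_distrib_right mult.assoc)
    also have "\<dots> = (\<Sum>i\<in>{1..k j}. ennreal (real (k j choose i)) * (\<integral>\<^sup>+y\<in>corner_box h. ?I (c(j := real i)) y \<partial>lborel)) + e j"
      unfolding e_def by (subst nn_integral_add) (auto simp: nn_integral_sum nn_integral_cmult)
    also have "\<dots> \<le> (\<Sum>i\<in>{1..k j}. ennreal (real (k j choose i)) * (?P * ?E)) + e j"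
    proof (intro add_right_mono sum_mono mult_left_mono)
      fix i assume "i \<in> {1..k j}"
      then show "(\<integral>\<^sup>+y\<in>corner_box h. ?I (c(j := real i)) y \<partial>lborel) \<le> ?P * ?E"
        using insert.prems insert.hyps by (intro insert.IH) auto
    qed auto
    also have "\<dots> \<le> ennreal (2 ^ k j) * (?P * ?E) + e j"
      unfolding sum_distrib_right[symmetric]
      by (intro add_right_mono mult_right_mono sum_binomial_le) auto
    \<comment> \<open>The new error is enlarged by a factor that is at least 1, so that all errors
      share one constant.\<close>
    also have "\<dots> \<le> ennreal (2 ^ k j) * (?P * ?E) + ennreal (2 ^ k j) * (?P * e j)"
    proof -
      have "1 \<le> (2 ^ k j * (\<Prod>j\<in>J. 2 ^ k j) :: real)"
        using prod_ge_1[of J "\<lambda>j. 2 ^ k j :: real"] one_le_power[of "2::real" "k j"]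
        by (intro mult_ge1_I) auto
      then have "1 * e j \<le> ennreal (2 ^ k j * (\<Prod>j\<in>J. 2 ^ k j)) * e j"
        by (intro mult_right_mono) (auto simp flip: ennreal_1 intro!: ennreal_leI)
      then show ?thesis
        by (intro add_left_mono) (simp add: ennreal_mult prod_nonneg mult.assoc)
    qed
    also have "\<dots> = ennreal (\<Prod>j\<in>insert j J. 2 ^ k j) * (ennreal (m * V) * avg_sup f V + (\<Sum>j\<in>insert j J. e j))"
      using insert.hyps by (simp add: ennreal_mult prod_nonneg distrib_left mult_ac add_ac)
    finally show ?case .
  qed
qed

text \<open>This is \<open>box_average_le\<close> with all directions in \<open>J\<close> and zero
  coefficients, divided by the volume of the box and the measure \<open>m\<close> of
  \<open>S\<close>. As \<open>t \<le> m\<close>, the negative powers of \<open>m\<close> are bounded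
  by those of \<open>t\<close>.\<close>

lemma avg_sup_le_differences:
  fixes f :: "real^'n \<Rightarrow> real" and h :: "'n \<Rightarrow> real"
  assumes [measurable]: "f \<in> borel_measurable borel"
    and t: "0 < t" and p: "\<And>j. 1 \<le> p j" and h: "\<And>j. 0 < h j"
  shows "avg_sup f t \<le> ennreal (\<Prod>j\<in>UNIV. 2 ^ k j) * (avg_sup f (\<Prod>j\<in>UNIV. h j) +
    (\<Sum>j\<in>UNIV. ennreal (2 * t powr (- 1 / p j) / h j) *
       (\<integral>\<^sup>+u\<in>{0<..<h j}. Lp_norm (p j) (difference j (k j) u f) \<partial>lborel)))"
  unfolding avg_sup_def[of f t]
proof (intro SUP_least, safe)
  fix S :: "(real^'n) set"
  assume S: "S \<in> sets lborel" "ennreal t \<le> emeasure lborel S" "emeasure lborel S < \<infinity>"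
  then obtain m where m: "emeasure lborel S = ennreal m" "t \<le> m"
    using t by (cases "emeasure lborel S") auto
  have m0: "0 < m"
    using t m by simp
  define V where "V = (\<Prod>j\<in>UNIV. h j)"
  have V: "0 < V"
    unfolding V_def using h by (intro prod_pos) auto
  let ?A = "ennreal (\<Prod>j\<in>UNIV. 2 ^ k j)"
  let ?\<phi> = "\<lambda>j. \<integral>\<^sup>+u\<in>{0<..<h j}. Lp_norm (p j) (difference j (k j) u f) \<partial>lborel"
  have "ennreal V * (\<integral>\<^sup>+x\<in>S. ennreal \<bar>f x\<bar> \<partial>lborel)
     = (\<integral>\<^sup>+y\<in>corner_box h. (\<integral>\<^sup>+x\<in>S. ennreal \<bar>f (x + scale_shift (\<lambda>_. 0) y)\<bar> \<partial>lborel) \<partial>lborel)"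
    by (simp add: scale_shift_def zero_vec_def[symmetric] nn_integral_cmult_indicator emeasure_corner_box h V_def)
      (rule mult.commute)
  also have "\<dots> \<le> ?A * (ennreal (m * V) * avg_sup f V + (\<Sum>j\<in>UNIV. ennreal (2 * m powr (1 - 1 / p j)) *
             (\<integral>\<^sup>+y\<in>corner_box h. Lp_norm (p j) (difference j (k j) (y $ j) f) \<partial>lborel)))"
    unfolding V_def using S m m0 p h by (intro box_average_le) auto
  also have "\<dots> \<le> ?A * (ennreal (m * V) * avg_sup f V + (\<Sum>j\<in>UNIV. ennreal (m * V) * (ennreal (2 * t powr (- 1 / p j) / h j) * ?\<phi> j)))"
  proof (intro mult_left_mono add_left_mono sum_mono)
    fix j
    have "2 * m powr (1 - 1 / p j) * (V / h j) = m * V * (2 * m powr (- 1 / p j) / h j)"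
      using m0 by (simp add: powr_diff powr_minus field_simps)
    also have "\<dots> \<le> m * V * (2 * t powr (- 1 / p j) / h j)"
      using m0 V h[of j] m t p[of j]
      by (intro mult_left_mono divide_right_mono powr_mono2') auto
    finally have "ennreal (2 * m powr (1 - 1 / p j) * (V / h j)) * ?\<phi> j
      \<le> ennreal (m * V * (2 * t powr (- 1 / p j) / h j)) * ?\<phi> j"
      by (intro mult_right_mono ennreal_leI) auto
    also have "ennreal (m * V * (2 * t powr (- 1 / p j) / h j)) * ?\<phi> j
       = ennreal (m * V) * (ennreal (2 * t powr (- 1 / p j) / h j) * ?\<phi> j)"
      using m0 V h[of j] by (subst ennreal_mult) (auto simp: mult.assoc)
    also have "ennreal (2 * m powr (1 - 1 / p j) * (V / h j)) * ?\<phi> j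
      = ennreal (2 * m powr (1 - 1 / p j)) *
             (\<integral>\<^sup>+y\<in>corner_box h. Lp_norm (p j) (difference j (k j) (y $ j) f) \<partial>lborel)"
    proof -
      have "(\<integral>\<^sup>+y\<in>corner_box h. Lp_norm (p j) (difference j (k j) (y $ j) f) \<partial>lborel) = ennreal (V / h j) * ?\<phi> j"
        unfolding V_def by (rule nn_integral_corner_box) (auto simp: h)
      then show ?thesis
        using m0 V h[of j] by (subst ennreal_mult) (auto simp: mult.assoc)
    qed
    finally show "ennreal (2 * m powr (1 - 1 / p j)) *
             (\<integral>\<^sup>+y\<in>corner_box h. Lp_norm (p j) (difference j (k j) (y $ j) f) \<partial>lborel)
       \<le> ennreal (m * V) * (ennreal (2 * t powr (- 1 / p j) / h j) * ?\<phi> j)" .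
  qed auto
  also have "\<dots> = ennreal V * (ennreal m * (?A * (avg_sup f V + (\<Sum>j\<in>UNIV. ennreal (2 * t powr (- 1 / p j) / h j) * ?\<phi> j))))"
    using m0 V by (simp add: ennreal_mult sum_distrib_left[symmetric] distrib_left[symmetric] mult_ac)
  finally have "(\<integral>\<^sup>+x\<in>S. ennreal \<bar>f x\<bar> \<partial>lborel) \<le> ennreal m * (?A * (avg_sup f V + (\<Sum>j\<in>UNIV. ennreal (2 * t powr (- 1 / p j) / h j) * ?\<phi> j)))"
    using V by (subst (asm) ennreal_mult_le_mult_iff) auto
  then show "(\<integral>\<^sup>+x\<in>S. ennreal \<bar>f x\<bar> \<partial>lborel) / emeasure lborel S
     \<le> ?A * (avg_sup f (\<Prod>j\<in>UNIV. h j) + (\<Sum>j\<in>UNIV. ennreal (2 * t powr (- 1 / p j) / h j) * ?\<phi> j))"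
    unfolding m(1) V_def using m0 by (intro divide_le_posI_ennreal) auto
qed

section \<open>Smoothing on the logarithmic scale\<close>

text \<open>In the variable \<open>ln u\<close> this is convolution with the kernel
  \<open>exp (- \<gamma> * \<bar>x\<bar>)\<close>; the factor \<open>1 / u\<close> is the density of
  the logarithmic measure.\<close>

definition log_smooth :: "real \<Rightarrow> (real \<Rightarrow> ennreal) \<Rightarrow> real \<Rightarrow> ennreal" where
  "log_smooth \<gamma> w v = (\<integral>\<^sup>+u\<in>{0<..}. w u * ennreal (exp (- \<gamma> * \<bar>ln u - v\<bar>) / u) \<partial>lborel)"

text \<open>On either side of \<open>exp v\<close> the kernel is a multiple of a power of
  \<open>u\<close>, with exponents \<open>\<gamma> - 1\<close> and \<open>- \<gamma> - 1\<close>.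
  Each side contributes \<open>1 / \<gamma>\<close>.\<close>

lemma log_kernel_integral_le:
  assumes "0 < \<gamma>"
  shows "(\<integral>\<^sup>+u\<in>{0<..}. ennreal (exp (- \<gamma> * \<bar>ln u - v\<bar>) / u) \<partial>lborel) \<le> ennreal (2 / \<gamma>)"
proof -
  let ?lo = "\<lambda>u::real. exp (- \<gamma> * v) * u powr (\<gamma> - 1)" and ?hi = "\<lambda>u::real. exp (\<gamma> * v) * u powr (- \<gamma> - 1)"
  have lo: "(?lo has_integral exp (- \<gamma> * v) * (exp v powr (\<gamma> - 1 + 1) / (\<gamma> - 1 + 1))) {0..exp v}"
    using assms by (intro has_integral_mult_right has_integral_powr_from_0) auto
  have hi: "(?hi has_integral exp (\<gamma> * v) * (- (exp v powr (- \<gamma> - 1 + 1)) / (- \<gamma> - 1 + 1))) {exp v..}"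
    using assms by (intro has_integral_mult_right has_integral_powr_to_inf) auto
  have "(\<integral>\<^sup>+u\<in>{0<..}. ennreal (exp (- \<gamma> * \<bar>ln u - v\<bar>) / u) \<partial>lborel)
     \<le> (\<integral>\<^sup>+u. ennreal (?lo u) * indicator {0..exp v} u + ennreal (?hi u) * indicator {exp v..} u \<partial>lborel)"
  proof (intro nn_integral_mono)
    fix u :: real
    show "ennreal (exp (- \<gamma> * \<bar>ln u - v\<bar>) / u) * indicator {0<..} u
       \<le> ennreal (?lo u) * indicator {0..exp v} u + ennreal (?hi u) * indicator {exp v..} u"
    proof (cases "0 < u")
      case True
      have split: "u powr (s - 1) = exp (s * ln u) / u" for s
        using True by (simp add: powr_diff) (simp add: powr_def)
      show ?thesis
      proof (cases "u \<le> exp v")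
        case le: True
        then have "ln u \<le> v"
          using True by (metis ln_exp ln_mono)
        then have "exp (- \<gamma> * \<bar>ln u - v\<bar>) / u = ?lo u"
          unfolding split by (simp add: algebra_simps flip: exp_add)
        then show ?thesis
          using True le by (simp add: add_increasing2)
      next
        case False
        then have "v \<le> ln u"
          using True by (simp add: ln_ge_iff)
        then have "exp (- \<gamma> * \<bar>ln u - v\<bar>) / u = ?hi u"
          unfolding split by (simp add: algebra_simps flip: exp_add)
        then show ?thesis
          using True False by (simp add: add_increasing)
      qed
    qed simp
  qed
  also have "\<dots> = ennreal (exp (- \<gamma> * v) * (exp v powr (\<gamma> - 1 + 1) / (\<gamma> - 1 + 1)))
      + ennreal (exp (\<gamma> * v) * (- (exp v powr (- \<gamma> - 1 + 1)) / (- \<gamma> - 1 + 1)))"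
    using nn_integral_has_integral_lebesgue'[OF _ lo] nn_integral_has_integral_lebesgue'[OF _ hi]
    by (simp add: nn_integral_add)
  also have "\<dots> = ennreal (1 / \<gamma>) + ennreal (1 / \<gamma>)"
    by (simp add: powr_def flip: exp_add)
  also have "\<dots> = ennreal (2 / \<gamma>)"
    using assms by (simp flip: ennreal_plus)
  finally show ?thesis .
qed

text \<open>Triangle inequality in the exponent. Where the smoothing is positive and finite, its
  logarithm thus has Lipschitz constant \<open>\<gamma>\<close>, which the balancing needs.\<close>

lemma log_smooth_lipschitz:
  assumes "0 < \<gamma>" and [measurable]: "w \<in> borel_measurable borel"
  shows "log_smooth \<gamma> w v' \<le> ennreal (exp (\<gamma> * \<bar>v - v'\<bar>)) * log_smooth \<gamma> w v"
proof -
  have "w u * ennreal (exp (- \<gamma> * \<bar>ln u - v'\<bar>) / u) * indicator {0<..} u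
     \<le> ennreal (exp (\<gamma> * \<bar>v - v'\<bar>)) * (w u * ennreal (exp (- \<gamma> * \<bar>ln u - v\<bar>) / u) * indicator {0<..} u)" for u
  proof (cases "0 < u")
    case True
    have "\<gamma> * \<bar>ln u - v\<bar> \<le> \<gamma> * (\<bar>v - v'\<bar> + \<bar>ln u - v'\<bar>)"
      using assms by (intro mult_left_mono) auto
    then have "exp (- \<gamma> * \<bar>ln u - v'\<bar>) \<le> exp (\<gamma> * \<bar>v - v'\<bar>) * exp (- \<gamma> * \<bar>ln u - v\<bar>)"
      by (simp add: algebra_simps flip: exp_add)
    then have "ennreal (exp (- \<gamma> * \<bar>ln u - v'\<bar>) / u) \<le> ennreal (exp (\<gamma> * \<bar>v - v'\<bar>) * (exp (- \<gamma> * \<bar>ln u - v\<bar>) / u))"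
      using True by (intro ennreal_leI) (simp add: divide_right_mono)
    also have "\<dots> = ennreal (exp (\<gamma> * \<bar>v - v'\<bar>)) * ennreal (exp (- \<gamma> * \<bar>ln u - v\<bar>) / u)"
      using True by (subst ennreal_mult) auto
    finally have "w u * ennreal (exp (- \<gamma> * \<bar>ln u - v'\<bar>) / u)
       \<le> w u * (ennreal (exp (\<gamma> * \<bar>v - v'\<bar>)) * ennreal (exp (- \<gamma> * \<bar>ln u - v\<bar>) / u))"
      by (intro mult_left_mono) auto
    then show ?thesis
      using True by (simp add: mult_ac)
  qed simp
  then show ?thesis
    unfolding log_smooth_def by (subst nn_integral_cmult[symmetric]) (auto intro!: nn_integral_mono)
qed

text \<open>Hoelder's inequality for the kernel, whose mass is at most \<open>2 / \<gamma>\<close>,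
  obtained from \<open>le_epowr_add\<close> as before.\<close>

lemma log_smooth_holder:
  assumes \<gamma>: "0 < \<gamma>" and [measurable]: "w \<in> borel_measurable borel" and \<theta>: "1 \<le> \<theta>"
  shows "epowr (log_smooth \<gamma> w v) \<theta> \<le> ennreal ((1 + 2 / \<gamma>) powr \<theta>) * log_smooth \<gamma> (\<lambda>u. epowr (w u) \<theta>) v"
proof (cases "log_smooth \<gamma> (\<lambda>u. epowr (w u) \<theta>) v")
  case top
  moreover have "0 < 1 + 2 / \<gamma>"
    using \<gamma> by (simp add: add_pos_pos)
  ultimately show ?thesis
    by (simp add: ennreal_mult_top)
next
  case (real x)
  let ?\<kappa> = "\<lambda>u. ennreal (exp (- \<gamma> * \<bar>ln u - v\<bar>) / u) * indicator {0<..} u"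
  show ?thesis
  proof (cases "x = 0")
    case True
    then have "(\<integral>\<^sup>+u\<in>{0<..}. epowr (w u) \<theta> * ennreal (exp (- \<gamma> * \<bar>ln u - v\<bar>) / u) \<partial>lborel) = 0"
      using real by (simp add: log_smooth_def)
    then have "AE u in lborel. epowr (w u) \<theta> * ennreal (exp (- \<gamma> * \<bar>ln u - v\<bar>) / u) * indicator {0<..} u = 0"
      by (subst (asm) nn_integral_0_iff_AE) auto
    then have "log_smooth \<gamma> w v = (\<integral>\<^sup>+u. 0 \<partial>(lborel :: real measure))"
      unfolding log_smooth_def by (intro nn_integral_cong_AE) auto
    then show ?thesis by simp
  next
    case False
    \<comment> \<open>With this threshold the first term becomes \<open>a\<close> and the second is
      at most \<open>a * (2 / \<gamma>)\<close>.\<close>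
    define a where "a = x powr (1 / \<theta>)"
    have a: "0 < a" "a powr \<theta> = x"
      using False real \<theta> by (auto simp: a_def powr_powr)
    have "log_smooth \<gamma> w v \<le> (\<integral>\<^sup>+u. ennreal (a powr (1 - \<theta>)) * (epowr (w u) \<theta> * ?\<kappa> u) + ennreal a * ?\<kappa> u \<partial>lborel)"
      unfolding log_smooth_def
    proof (intro nn_integral_mono)
      fix u
      have "w u * ?\<kappa> u \<le> (ennreal (a powr (1 - \<theta>)) * epowr (w u) \<theta> + ennreal a) * ?\<kappa> u"
        by (intro mult_right_mono le_epowr_add a \<theta>) auto
      then show "w u * ennreal (exp (- \<gamma> * \<bar>ln u - v\<bar>) / u) * indicator {0<..} u
        \<le> ennreal (a powr (1 - \<theta>)) * (epowr (w u) \<theta> * ?\<kappa> u) + ennreal a * ?\<kappa> u"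
        by (simp only: distrib_right mult.assoc)
    qed
    also have "\<dots> = ennreal (a powr (1 - \<theta>)) * log_smooth \<gamma> (\<lambda>u. epowr (w u) \<theta>) v
        + ennreal a * (\<integral>\<^sup>+u\<in>{0<..}. ennreal (exp (- \<gamma> * \<bar>ln u - v\<bar>) / u) \<partial>lborel)"
      unfolding log_smooth_def mult.assoc by (subst nn_integral_add) (auto simp: nn_integral_cmult)
    also have "\<dots> \<le> ennreal (a powr (1 - \<theta>)) * ennreal x + ennreal a * ennreal (2 / \<gamma>)"
      using real by (intro add_mono mult_left_mono log_kernel_integral_le \<gamma>) auto
    also have "\<dots> = ennreal (a powr (1 - \<theta>) * x + a * (2 / \<gamma>))"
      using a \<gamma> real by (simp flip: ennreal_mult ennreal_plus)
    also have "a powr (1 - \<theta>) * x = a"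
      using a \<theta> False by (simp add: powr_diff)
    also have "a + a * (2 / \<gamma>) = (1 + 2 / \<gamma>) * a"
      by (simp add: algebra_simps)
    finally have "epowr (log_smooth \<gamma> w v) \<theta> \<le> epowr (ennreal ((1 + 2 / \<gamma>) * a)) \<theta>"
      using \<theta> by (intro epowr_mono) auto
    also have "\<dots> = ennreal ((1 + 2 / \<gamma>) powr \<theta>) * ennreal x"
      using a \<gamma> by (subst epowr_ennreal) (auto simp: powr_mult ennreal_mult)
    finally show ?thesis
      using real by simp
  qed
qed

lemma log_smooth_le_of_AE:
  assumes \<gamma>: "0 < \<gamma>" and N: "0 \<le> N" and ae: "AE u in lborel. 0 < u \<longrightarrow> w u \<le> ennreal N"
  shows "log_smooth \<gamma> w v \<le> ennreal (2 / \<gamma> * N)"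
proof -
  have "log_smooth \<gamma> w v \<le> (\<integral>\<^sup>+u. ennreal N * (ennreal (exp (- \<gamma> * \<bar>ln u - v\<bar>) / u) * indicator {0<..} u) \<partial>lborel)"
    unfolding log_smooth_def using ae
    by (intro nn_integral_mono_AE) (auto intro!: mult_right_mono simp: indicator_def)
  also have "\<dots> = ennreal N * (\<integral>\<^sup>+u\<in>{0<..}. ennreal (exp (- \<gamma> * \<bar>ln u - v\<bar>) / u) \<partial>lborel)"
    by (simp add: nn_integral_cmult)
  also have "\<dots> \<le> ennreal N * ennreal (2 / \<gamma>)"
    by (intro mult_left_mono log_kernel_integral_le \<gamma>) auto
  also have "ennreal N * ennreal (2 / \<gamma>) = ennreal (2 / \<gamma> * N)"
    using \<gamma> N by (simp add: mult.commute flip: ennreal_mult)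
  finally show ?thesis .
qed

text \<open>For \<open>u < h\<close> one has
  \<open>u powr r / h = h powr r * (u / h) powr (r + 1) / u\<close>, and
  \<open>\<gamma> \<le> r + 1\<close> bounds \<open>(u / h) powr (r + 1)\<close> by the kernel
  centred at \<open>ln h\<close>.\<close>

lemma average_le_log_smooth:
  assumes \<gamma>: "0 < \<gamma>" "\<gamma> \<le> r + 1" and h: "0 < h" and [measurable]: "w \<in> borel_measurable borel"
  shows "ennreal (1 / h) * (\<integral>\<^sup>+u\<in>{0<..<h}. ennreal (u powr r) * w u \<partial>lborel)
     \<le> ennreal (h powr r) * log_smooth \<gamma> w (ln h)"
proof -
  have "(\<integral>\<^sup>+u\<in>{0<..<h}. ennreal (u powr r) * w u \<partial>lborel)
     \<le> (\<integral>\<^sup>+u. ennreal (h powr (r + 1)) * (w u * ennreal (exp (- \<gamma> * \<bar>ln u - ln h\<bar>) / u) * indicator {0<..} u) \<partial>lborel)"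
  proof (intro nn_integral_mono)
    fix u
    show "ennreal (u powr r) * w u * indicator {0<..<h} u
      \<le> ennreal (h powr (r + 1)) * (w u * ennreal (exp (- \<gamma> * \<bar>ln u - ln h\<bar>) / u) * indicator {0<..} u)"
    proof (cases "0 < u \<and> u < h")
      case True
      have ln: "ln u \<le> ln h"
        using True h by simp
      then have "\<gamma> * (ln h - ln u) \<le> (r + 1) * (ln h - ln u)"
        using \<gamma> by (intro mult_right_mono) auto
      then have "exp ((r + 1) * ln u) \<le> exp ((r + 1) * ln h) * exp (- \<gamma> * \<bar>ln u - ln h\<bar>)"
        using ln by (simp add: algebra_simps flip: exp_add)
      then have "u powr (r + 1) \<le> h powr (r + 1) * exp (- \<gamma> * \<bar>ln u - ln h\<bar>)"
        using True h by (simp add: powr_def)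
      moreover have "u powr r = u powr (r + 1) / u"
        using True by (simp add: powr_add)
      ultimately have "u powr r \<le> h powr (r + 1) * (exp (- \<gamma> * \<bar>ln u - ln h\<bar>) / u)"
        using True by (simp add: divide_right_mono)
      then have "ennreal (u powr r) \<le> ennreal (h powr (r + 1) * (exp (- \<gamma> * \<bar>ln u - ln h\<bar>) / u))"
        by (rule ennreal_leI)
      also have "\<dots> = ennreal (h powr (r + 1)) * ennreal (exp (- \<gamma> * \<bar>ln u - ln h\<bar>) / u)"
        using True by (subst ennreal_mult) auto
      finally have "ennreal (u powr r) * w u \<le> ennreal (h powr (r + 1)) * ennreal (exp (- \<gamma> * \<bar>ln u - ln h\<bar>) / u) * w u"
        by (intro mult_right_mono) auto
      then show ?thesis
        using True by (simp add: mult_ac)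
    qed auto
  qed
  also have "\<dots> = ennreal (h powr (r + 1)) * log_smooth \<gamma> w (ln h)"
    unfolding log_smooth_def by (rule nn_integral_cmult) measurable
  finally have "ennreal (1 / h) * (\<integral>\<^sup>+u\<in>{0<..<h}. ennreal (u powr r) * w u \<partial>lborel)
     \<le> ennreal (1 / h) * (ennreal (h powr (r + 1)) * log_smooth \<gamma> w (ln h))"
    by (intro mult_left_mono) auto
  also have "\<dots> = ennreal (1 / h * h powr (r + 1)) * log_smooth \<gamma> w (ln h)"
    using h by (subst ennreal_mult) (auto simp: mult.assoc)
  also have "1 / h * h powr (r + 1) = h powr r"
    using h by (simp add: powr_add)
  finally show ?thesis .
qed

text \<open>After exchanging sum and integral, the kernels centred at separated points add up to at
  most a constant at every \<open>u\<close>.\<close>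

lemma sum_log_smooth_le:
  fixes v :: "int \<Rightarrow> real"
  assumes \<gamma>: "0 < \<gamma>" and [measurable]: "w \<in> borel_measurable borel"
    and \<delta>: "0 < \<delta>" and sep: "\<And>m m'. m < m' \<Longrightarrow> \<delta> \<le> v m' - v m" and "finite F"
  shows "(\<Sum>m\<in>F. log_smooth \<gamma> w (v m)) \<le> ennreal (exp (\<gamma> * \<delta>) * (2 / (1 - exp (- \<gamma> * \<delta>)))) *
     (\<integral>\<^sup>+u\<in>{0<..}. w u * ennreal (1 / u) \<partial>lborel)" (is "_ \<le> ennreal ?C * _")
proof -
  have "(\<Sum>m\<in>F. log_smooth \<gamma> w (v m))
     = (\<integral>\<^sup>+u. (\<Sum>m\<in>F. w u * ennreal (exp (- \<gamma> * \<bar>ln u - v m\<bar>) / u) * indicator {0<..} u) \<partial>lborel)"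
    unfolding log_smooth_def by (subst nn_integral_sum) auto
  also have "\<dots> \<le> (\<integral>\<^sup>+u. ennreal ?C * (w u * ennreal (1 / u) * indicator {0<..} u) \<partial>lborel)"
  proof (intro nn_integral_mono)
    fix u :: real
    show "(\<Sum>m\<in>F. w u * ennreal (exp (- \<gamma> * \<bar>ln u - v m\<bar>) / u) * indicator {0<..} u)
      \<le> ennreal ?C * (w u * ennreal (1 / u) * indicator {0<..} u)"
    proof (cases "0 < u")
      case True
      have "(\<Sum>m\<in>F. exp (- \<gamma> * \<bar>ln u - v m\<bar>)) * (1 / u) \<le> ?C * (1 / u)"
        using True assms by (intro mult_right_mono sum_exp_separated_le) auto
      then have "ennreal (\<Sum>m\<in>F. exp (- \<gamma> * \<bar>ln u - v m\<bar>) / u) \<le> ennreal (?C * (1 / u))"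
        by (intro ennreal_leI) (simp add: sum_divide_distrib)
      also have "\<dots> = ennreal ?C * ennreal (1 / u)"
        using True \<gamma> \<delta> by (intro ennreal_mult) auto
      finally have "(\<Sum>m\<in>F. ennreal (exp (- \<gamma> * \<bar>ln u - v m\<bar>) / u)) \<le> ennreal ?C * ennreal (1 / u)"
        using True by (subst sum_ennreal) auto
      then have "w u * (\<Sum>m\<in>F. ennreal (exp (- \<gamma> * \<bar>ln u - v m\<bar>) / u)) \<le> w u * (ennreal ?C * ennreal (1 / u))"
        by (intro mult_left_mono) auto
      then show ?thesis
        using True by (simp add: sum_distrib_left mult_ac del: sum_ennreal)
    qed simp
  qed
  also have "\<dots> = ennreal ?C * (\<integral>\<^sup>+u\<in>{0<..}. w u * ennreal (1 / u) \<partial>lborel)"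
    by (rule nn_integral_cmult) measurable
  finally show ?thesis .
qed

text \<open>The outer norm of the Besov seminorm, separated from the differences so that the
  smoothing estimates can be stated for arbitrary \<open>w\<close>.\<close>

definition dh_norm :: "ennreal \<Rightarrow> (real \<Rightarrow> ennreal) \<Rightarrow> ennreal" where
  "dh_norm \<theta> w =
     (if \<theta> = \<infinity> then esssup (restrict_space lebesgue {0<..}) w
      else epowr (\<integral>\<^sup>+h\<in>{0<..}. epowr (w h) (enn2real \<theta>) * ennreal (1 / h) \<partial>lebesgue) (1 / enn2real \<theta>))"

text \<open>\<open>M\<close> is chosen before \<open>w\<close>, \<open>N\<close> and the points,
  because the final constant must not depend on the function. For infinite \<open>\<theta>\<close>
  the uniform bound comes from the essential supremum, for finite \<open>\<theta>\<close> from the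
  summed bound.\<close>

lemma log_smooth_dh_norm:
  fixes v :: "int \<Rightarrow> real"
  assumes \<theta>: "1 \<le> \<theta>" and \<gamma>: "0 < \<gamma>" and \<delta>: "0 < \<delta>"
  shows "\<exists>M>0. \<forall>w N. w \<in> borel_measurable borel \<and> dh_norm \<theta> w = ennreal N \<and> 0 \<le> N \<longrightarrow>
     (\<forall>x. log_smooth \<gamma> w x \<le> ennreal (M * N)) \<and>
     (\<theta> \<noteq> \<infinity> \<longrightarrow> (\<forall>v F. (\<forall>m m'. m < m' \<longrightarrow> \<delta> \<le> v m' - v m) \<and> finite (F :: int set) \<longrightarrow>
       (\<Sum>m\<in>F. epowr (log_smooth \<gamma> w (v m)) (enn2real \<theta>)) \<le> ennreal ((M * N) powr enn2real \<theta>)))"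
proof -
  define C where "C = exp (\<gamma> * \<delta>) * (2 / (1 - exp (- \<gamma> * \<delta>)))"
  have C: "0 < C"
    using \<gamma> \<delta> by (simp add: C_def)
  \<comment> \<open>The first factor is the constant of \<open>log_smooth_holder\<close>. The second
    absorbs \<open>C\<close> for every finite exponent \<open>s \<ge> 1\<close>, as
    \<open>C \<le> (1 + C) powr s\<close>.\<close>
  define M where "M = (1 + 2 / \<gamma>) * (1 + C)"
  have M: "0 < M"
    using \<gamma> C by (auto simp: M_def intro!: mult_pos_pos add_pos_pos)
  have main: "(\<forall>x. log_smooth \<gamma> w x \<le> ennreal (M * N)) \<and>
     (\<theta> \<noteq> \<infinity> \<longrightarrow> (\<forall>v F. (\<forall>m m'. m < m' \<longrightarrow> \<delta> \<le> v m' - v m) \<and> finite (F :: int set) \<longrightarrow>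
       (\<Sum>m\<in>F. epowr (log_smooth \<gamma> w (v m)) (enn2real \<theta>)) \<le> ennreal ((M * N) powr enn2real \<theta>)))"
    if [measurable]: "w \<in> borel_measurable borel" and N: "dh_norm \<theta> w = ennreal N" "0 \<le> N" for w N
  proof (cases "\<theta> = \<infinity>")
    case True
    have "AE u in restrict_space lebesgue {0<..}. w u \<le> ennreal N"
      using esssup_AE[where M = "restrict_space lebesgue {0<..}" and f = w] N True by (simp add: dh_norm_def)
    then have "AE u in lborel. 0 < u \<longrightarrow> w u \<le> ennreal N"
      by (subst (asm) AE_restrict_space_iff) (auto simp: AE_completion_iff)
    then have "log_smooth \<gamma> w x \<le> ennreal (2 / \<gamma> * N)" for x
      by (rule log_smooth_le_of_AE[OF \<gamma> N(2)])
    moreover have "2 / \<gamma> * N \<le> M * N"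
    proof (intro mult_right_mono N)
      have "2 / \<gamma> * 1 \<le> M"
        unfolding M_def using \<gamma> C by (intro mult_mono) auto
      then show "2 / \<gamma> \<le> M" by simp
    qed
    ultimately show ?thesis
      using True by (auto intro: order_trans ennreal_leI)
  next
    case False
    define s where "s = enn2real \<theta>"
    have s: "1 \<le> s"
      using \<theta> False by (cases \<theta>) (auto simp: s_def)
    have "epowr (dh_norm \<theta> w) s = (\<integral>\<^sup>+h\<in>{0<..}. epowr (w h) s * ennreal (1 / h) \<partial>lborel)"
      using False s by (simp add: dh_norm_def s_def[symmetric] nn_integral_completion epowr_epowr)
    then have int: "(\<integral>\<^sup>+h\<in>{0<..}. epowr (w h) s * ennreal (1 / h) \<partial>lborel) = ennreal (N powr s)"
      using N by simp
    have sum: "(\<Sum>m\<in>F. epowr (log_smooth \<gamma> w (v m)) s) \<le> ennreal ((M * N) powr s)"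
      if "\<forall>m m'. m < m' \<longrightarrow> \<delta> \<le> v m' - v m" "finite F" for v :: "int \<Rightarrow> real" and F
    proof -
      have "(\<Sum>m\<in>F. epowr (log_smooth \<gamma> w (v m)) s)
         \<le> ennreal ((1 + 2 / \<gamma>) powr s) * (\<Sum>m\<in>F. log_smooth \<gamma> (\<lambda>u. epowr (w u) s) (v m))"
        unfolding sum_distrib_left by (intro sum_mono log_smooth_holder \<gamma> s) auto
      also have "\<dots> \<le> ennreal ((1 + 2 / \<gamma>) powr s) * (ennreal C * ennreal (N powr s))"
        unfolding C_def int[symmetric] using that
        by (intro mult_left_mono sum_log_smooth_le \<gamma> \<delta>) auto
      also have "\<dots> = ennreal ((1 + 2 / \<gamma>) powr s * C * N powr s)"
        using C by (simp add: ennreal_mult mult.assoc)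
      also have "\<dots> \<le> ennreal ((1 + 2 / \<gamma>) powr s * (1 + C) powr s * N powr s)"
        using C s powr_mono[of 1 s "1 + C"]
        by (intro ennreal_leI mult_right_mono mult_left_mono) auto
      also have "\<dots> = ennreal ((M * N) powr s)"
        unfolding M_def using \<gamma> C N by (simp add: powr_mult)
      finally show ?thesis .
    qed
    \<comment> \<open>A sum with one term suffices: \<open>x\<close> is the point of index 0 of an
      arithmetic progression with difference \<open>\<delta>\<close>.\<close>
    have "log_smooth \<gamma> w x \<le> ennreal (M * N)" for x
    proof -
      have "m < m' \<Longrightarrow> \<delta> \<le> \<delta> * real_of_int m' - \<delta> * real_of_int m" for m m'
        using \<delta> mult_left_mono[of 1 "real_of_int (m' - m)" \<delta>] by (simp add: algebra_simps)
      then have "epowr (log_smooth \<gamma> w x) s \<le> ennreal ((M * N) powr s)"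
        using sum[of "\<lambda>m. x + \<delta> * real_of_int m" "{0}"] by simp
      then have "epowr (epowr (log_smooth \<gamma> w x) s) (1 / s) \<le> epowr (ennreal ((M * N) powr s)) (1 / s)"
        using s by (intro epowr_mono) auto
      then show ?thesis
        using s M N by (simp add: epowr_epowr powr_powr)
    qed
    with sum show ?thesis
      by (auto simp: s_def)
  qed
  show ?thesis
    by (intro exI[of _ M] conjI M allI impI main) auto
qed

section \<open>Summation over a geometric progression\<close>

lemma powr_half_sum_le:
  fixes x y \<theta> :: real
  assumes "0 \<le> x" "0 \<le> y" "1 \<le> \<theta>"
  shows "(x / 2 + y / 2) powr \<theta> \<le> x powr \<theta> / 2 + y powr \<theta> / 2"
proof (cases "x = 0 \<or> y = 0")
  case True
  have "(1 / 2) powr \<theta> \<le> (1 / 2) powr 1"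
    using assms by (intro powr_mono') auto
  then have "(1 / 2) powr \<theta> * z powr \<theta> \<le> 1 / 2 * z powr \<theta>" for z
    by (intro mult_right_mono) auto
  then have "(1 / 2 * z) powr \<theta> \<le> 1 / 2 * z powr \<theta>" if "0 \<le> z" for z
    using that by (simp only: powr_mult)
  with assms True show ?thesis
    by (auto simp: mult.commute)
next
  case False
  then show ?thesis
    using assms convex_onD[OF powr_convex[OF assms(3)], of "1/2" x y] by simp
qed

text \<open>By convexity a window sum is at most half of the sum over the window shifted by one,
  plus \<open>Y / 2\<close>. The shift adds a single new term, which tends to 0, and half of the
  finite window sum can be subtracted.\<close>

lemma sum_powr_absorb:
  fixes a b :: "int \<Rightarrow> real"
  assumes a: "\<And>m. 0 \<le> a m" and b: "\<And>m. 0 \<le> b m"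
    and step: "\<And>m. a m \<le> a (m + 1) / 2 + b m / 2"
    and lim: "(\<lambda>i. a (int i)) \<longlonglongrightarrow> 0" and \<theta>: "1 \<le> \<theta>"
    and Y: "\<And>F. finite F \<Longrightarrow> (\<Sum>m\<in>F. b m powr \<theta>) \<le> Y"
  shows "(\<Sum>m\<in>{- int M..int M}. a m powr \<theta>) \<le> Y"
proof -
  define S where "S M = (\<Sum>m\<in>{- int M..int M}. a m powr \<theta>)" for M
  have S_le: "S M \<le> a (int M + 1) powr \<theta> + Y" for M
  proof -
    have "S M \<le> (\<Sum>m\<in>{- int M..int M}. a (m + 1) powr \<theta> / 2 + b m powr \<theta> / 2)"
      unfolding S_def
    proof (rule sum_mono)
      fix m
      have "a m powr \<theta> \<le> (a (m + 1) / 2 + b m / 2) powr \<theta>"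
        using \<theta> by (intro powr_mono2 step a) auto
      also have "\<dots> \<le> a (m + 1) powr \<theta> / 2 + b m powr \<theta> / 2"
        by (intro powr_half_sum_le a b \<theta>)
      finally show "a m powr \<theta> \<le> a (m + 1) powr \<theta> / 2 + b m powr \<theta> / 2" .
    qed
    also have "\<dots> = (\<Sum>m\<in>{- int M..int M}. a (m + 1) powr \<theta>) / 2 + (\<Sum>m\<in>{- int M..int M}. b m powr \<theta>) / 2"
      by (simp add: sum.distrib sum_divide_distrib)
    also have "(\<Sum>m\<in>{- int M..int M}. a (m + 1) powr \<theta>) = (\<Sum>m\<in>{- int M + 1..int M + 1}. a m powr \<theta>)"
      by (rule sum.reindex_bij_witness[of _ "\<lambda>m. m - 1" "\<lambda>m. m + 1"]) auto
    also have "\<dots> \<le> (\<Sum>m\<in>insert (int M + 1) {- int M..int M}. a m powr \<theta>)"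
      by (intro sum_mono2) auto
    also have "\<dots> = a (int M + 1) powr \<theta> + S M"
      by (simp add: S_def)
    finally show ?thesis
      using Y[of "{- int M..int M}"] by (simp add: field_simps)
  qed
  have lim1: "(\<lambda>i. a (int (Suc i)) powr \<theta> + Y) \<longlonglongrightarrow> 0 powr \<theta> + Y"
    using LIMSEQ_Suc[OF lim] \<theta> a by (intro tendsto_add tendsto_powr' tendsto_const) auto
  \<comment> \<open>The window is enlarged first, so that the boundary term can tend to 0 while
    \<open>M\<close> stays fixed.\<close>
  have "S M \<le> a (int (Suc M')) powr \<theta> + Y" if "M \<le> M'" for M'
  proof -
    have "S M \<le> S M'"
      unfolding S_def using that by (intro sum_mono2) auto
    with S_le[of M'] show ?thesis
      by (simp add: add.commute)
  qed
  then have "S M \<le> 0 powr \<theta> + Y"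
    by (intro LIMSEQ_le_const[OF lim1]) auto
  then show ?thesis
    using \<theta> by (simp add: S_def)
qed

text \<open>A value above \<open>Y\<close> would make the sequence nondecreasing from there on,
  contrary to the limit 0.\<close>

lemma sup_absorb:
  fixes a b :: "int \<Rightarrow> real"
  assumes step: "\<And>m. a m \<le> a (m + 1) / 2 + b m / 2"
    and lim: "(\<lambda>i. a (int i)) \<longlonglongrightarrow> 0" and Y: "\<And>m. b m \<le> Y" "0 \<le> Y"
  shows "a m \<le> Y"
proof (rule ccontr)
  assume less: "\<not> a m \<le> Y"
  have grow: "a m \<le> a (m + int i)" for i
  proof (induction i)
    case (Suc i)
    then show ?case
      using step[of "m + int i"] Y(1)[of "m + int i"] less by (simp add: add_ac)
  qed simp
  have "a m \<le> 0"
  proof (rule LIMSEQ_le_const[OF lim])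
    show "\<exists>N. \<forall>n\<ge>N. a m \<le> a (int n)"
    proof (intro exI[of _ "nat \<bar>m\<bar>"] allI impI)
      fix i assume "nat \<bar>m\<bar> \<le> i"
      then show "a m \<le> a (int i)"
        using grow[of "nat (int i - m)"] by (simp split: if_splits)
    qed
  qed
  with less Y show False by simp
qed

section \<open>From a geometric progression of levels to integrals, and products of powers\<close>

lemma geometric_level_exists:
  assumes "1 < B" "0 < (t::real)"
  obtains m :: int where "B powr m \<le> t" "t < B powr (m + 1)"
proof (rule that)
  show "B powr \<lfloor>log B t\<rfloor> \<le> t" "t < B powr (\<lfloor>log B t\<rfloor> + 1)"
    using assms by (simp_all add: powr_le_iff less_powr_iff)
qed

text \<open>On the block from \<open>B powr m\<close> to \<open>B powr (m + 1)\<close> the factor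
  \<open>1 / t\<close> is at most \<open>B powr - m\<close>, and the block is shorter than
  \<open>B powr (m + 1)\<close>. So it contributes at most \<open>B * c m\<close>; monotone
  convergence adds up the blocks.\<close>

lemma nn_integral_dyadic_le:
  fixes H :: "real \<Rightarrow> ennreal" and c :: "int \<Rightarrow> real"
  assumes B: "1 < B" and c: "\<And>m. 0 \<le> c m"
    and H: "\<And>m t. B powr m \<le> t \<Longrightarrow> t < B powr (m + 1) \<Longrightarrow> H t \<le> ennreal (c m)"
    and Y: "\<And>M. (\<Sum>m\<in>{- int M..int M}. c m) \<le> Y"
  shows "(\<integral>\<^sup>+t\<in>{0<..}. H t * ennreal (1 / t) \<partial>lborel) \<le> ennreal (B * Y)"
proof -
  define s where "s M t = (\<Sum>m\<in>{- int M..int M}.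
      ennreal (c m * B powr - m) * indicator {B powr m..<B powr (m + 1)} t)" for M :: nat and t :: real
  have [measurable]: "s M \<in> borel_measurable borel" for M
    unfolding s_def by measurable
  have inc: "incseq s"
    unfolding incseq_def le_fun_def s_def by (intro allI impI sum_mono2) auto
  have "(\<integral>\<^sup>+t\<in>{0<..}. H t * ennreal (1 / t) \<partial>lborel) \<le> (\<integral>\<^sup>+t. (SUP M. s M t) \<partial>lborel)"
  proof (intro nn_integral_mono)
    fix t :: real
    show "H t * ennreal (1 / t) * indicator {0<..} t \<le> (SUP M. s M t)"
    proof (cases "0 < t")
      case True
      obtain m :: int where m: "B powr m \<le> t" "t < B powr (m + 1)"
        using geometric_level_exists[OF B True] by blast
      have "1 / t \<le> B powr - m"
        using m(1) B True by (simp add: powr_minus_divide frac_le)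
      then have "H t * ennreal (1 / t) \<le> ennreal (c m) * ennreal (B powr - m)"
        using H[OF m] by (intro mult_mono ennreal_leI) auto
      also have "\<dots> = ennreal (c m * B powr - m) * indicator {B powr m..<B powr (m + 1)} t"
        using m c[of m] by (simp add: ennreal_mult)
      also have "\<dots> \<le> s (nat \<bar>m\<bar>) t"
        unfolding s_def by (rule member_le_sum) auto
      also have "\<dots> \<le> (SUP M. s M t)"
        by (intro SUP_upper) auto
      finally show ?thesis
        using True by simp
    qed simp
  qed
  also have "\<dots> = (SUP M. \<integral>\<^sup>+t. s M t \<partial>lborel)"
    by (intro nn_integral_monotone_convergence_SUP inc) measurable
  also have "\<dots> \<le> ennreal (B * Y)"
  proof (intro SUP_least)
    fix M
    have "(\<integral>\<^sup>+t. s M t \<partial>lborel) = (\<Sum>m\<in>{- int M..int M}. ennreal (c m * B powr - m) * ennreal (B powr (m + 1) - B powr m))"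
      unfolding s_def using B by (subst nn_integral_sum) (auto simp: nn_integral_cmult_indicator)
    also have "\<dots> \<le> (\<Sum>m\<in>{- int M..int M}. ennreal (B * c m))"
    proof (intro sum_mono)
      fix m :: int
      have "B powr - m * B powr (m + 1) = B"
        using B by (simp flip: powr_add)
      then have "c m * B powr - m * (B powr (m + 1) - B powr m) \<le> B * c m"
        using c[of m] B by (simp add: right_diff_distrib mult.assoc)
      then show "ennreal (c m * B powr - m) * ennreal (B powr (m + 1) - B powr m) \<le> ennreal (B * c m)"
        using c[of m] B by (subst ennreal_mult[symmetric]) (auto intro: ennreal_leI)
    qed
    also have "\<dots> = ennreal (B * (\<Sum>m\<in>{- int M..int M}. c m))"
      using c B by (simp add: sum_distrib_left)
    also have "\<dots> \<le> ennreal (B * Y)"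
      using Y[of M] B by (intro ennreal_leI mult_left_mono) auto
    finally show "(\<integral>\<^sup>+t. s M t \<partial>lborel) \<le> ennreal (B * Y)" .
  qed
  finally show ?thesis .
qed

text \<open>Weighted AM-GM inequality: convexity of \<open>exp\<close> at the points
  \<open>ln (x j)\<close>.\<close>

lemma prod_powr_le_sum:
  fixes x a :: "'j::finite \<Rightarrow> real"
  assumes "\<And>j. 0 < x j" "\<And>j. 0 \<le> a j" "(\<Sum>j\<in>UNIV. a j) = 1"
  shows "(\<Prod>j\<in>UNIV. x j powr a j) \<le> (\<Sum>j\<in>UNIV. a j * x j)"
proof -
  have "(\<Prod>j\<in>UNIV. x j powr a j) = exp (\<Sum>j\<in>UNIV. a j *\<^sub>R ln (x j))"
    using assms(1) by (simp add: exp_sum powr_def less_imp_neq[symmetric])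
  also have "\<dots> \<le> (\<Sum>j\<in>UNIV. a j * exp (ln (x j)))"
    using assms by (intro convex_on_sum[OF _ _ exp_convex]) auto
  finally show ?thesis
    using assms(1) by simp
qed

text \<open>Hoelder's inequality in normalised form, by the weighted AM-GM inequality. Here \<open>i j\<close> is
  the reciprocal of the \<open>j\<close>-th exponent, so that \<open>i j = 0\<close> encodes the exponent \<open>\<infinity>\<close>.\<close>

lemma sum_prod_powr_le:
  fixes y :: "'j::finite \<Rightarrow> int \<Rightarrow> real" and i w :: "'j \<Rightarrow> real"
  assumes y: "\<And>j m. 0 < y j m" "\<And>j m. y j m \<le> 1" and w: "\<And>j. 0 \<le> w j" and i: "\<And>j. 0 \<le> i j"
    and s: "0 < s" "(\<Sum>j\<in>UNIV. w j * i j) = 1 / s"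
    and sum: "\<And>j. i j \<noteq> 0 \<Longrightarrow> (\<Sum>m\<in>F. y j m powr (1 / i j)) \<le> 1"
  shows "(\<Sum>m\<in>F. (\<Prod>j\<in>UNIV. y j m powr w j) powr s) \<le> 1"
proof -
  \<comment> \<open>These are the weights of the AM-GM inequality; directions with exponent infinity
    get weight 0.\<close>
  have ws: "(\<Sum>j\<in>UNIV. s * w j * i j) = 1"
    using s by (simp add: sum_distrib_left[symmetric] mult.assoc)
  have "(\<Sum>m\<in>F. (\<Prod>j\<in>UNIV. y j m powr w j) powr s)
     \<le> (\<Sum>m\<in>F. \<Sum>j\<in>UNIV. s * w j * i j * y j m powr (1 / i j))"
  proof (intro sum_mono)
    fix m
    have "(\<Prod>j\<in>UNIV. y j m powr w j) powr s = (\<Prod>j\<in>UNIV. y j m powr (s * w j))"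
      using y by (simp add: prod_powr_distrib powr_powr mult.commute)
    also have "\<dots> \<le> (\<Prod>j\<in>UNIV. (y j m powr (1 / i j)) powr (s * w j * i j))"
    proof (intro prod_mono conjI)
      fix j
      show "y j m powr (s * w j) \<le> (y j m powr (1 / i j)) powr (s * w j * i j)"
      \<comment> \<open>For exponent infinity, division by 0 makes the right-hand side 1, and the
        left-hand side is at most 1 because \<open>y j m \<le> 1\<close>.\<close>
      proof (cases "i j = 0")
        case True
        have "y j m powr (s * w j) \<le> 1 powr (s * w j)"
          using y w s less_imp_le[OF y(1)] by (intro powr_mono2) auto
        then show ?thesis
          using True y(1)[of j m] by simp
      next
        case False
        then show ?thesis
          by (simp add: powr_powr)
      qed
    qed auto
    also have "\<dots> \<le> (\<Sum>j\<in>UNIV. s * w j * i j * y j m powr (1 / i j))"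
    proof (intro prod_powr_le_sum ws)
      show "0 < y j m powr (1 / i j)" for j
        using y(1)[of j m] by simp
      show "0 \<le> s * w j * i j" for j
        using w[of j] i[of j] s by simp
    qed
    finally show "(\<Prod>j\<in>UNIV. y j m powr w j) powr s \<le> (\<Sum>j\<in>UNIV. s * w j * i j * y j m powr (1 / i j))" .
  qed
  also have "\<dots> = (\<Sum>j\<in>UNIV. s * w j * i j * (\<Sum>m\<in>F. y j m powr (1 / i j)))"
    by (subst sum.swap) (simp add: sum_distrib_left)
  also have "\<dots> \<le> (\<Sum>j\<in>UNIV. s * w j * i j * 1)"
  proof (intro sum_mono)
    fix j
    show "s * w j * i j * (\<Sum>m\<in>F. y j m powr (1 / i j)) \<le> s * w j * i j * 1"
    proof (cases "i j = 0")
      case False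
      then show ?thesis
        using w[of j] i[of j] s by (intro mult_left_mono sum) auto
    qed simp
  qed
  finally show ?thesis
    using ws by simp
qed

section \<open>The embedding\<close>

lemma AE_translate:
  fixes P :: "'a::euclidean_space \<Rightarrow> bool"
  assumes "AE x in lborel. P x"
  shows "AE x in lborel. P (x + a)"
proof -
  obtain N where N: "N \<in> null_sets lborel" "{x. \<not> P x} \<subseteq> N"
    using assms by (auto simp: eventually_ae_filter)
  then have [measurable]: "N \<in> sets borel"
    by auto
  have "(\<integral>\<^sup>+x. indicator N (x + a) \<partial>lborel) = (\<integral>\<^sup>+x. indicator N x \<partial>(lborel :: 'a measure))"
    by (rule nn_integral_translate) measurable
  also have "\<dots> = 0"
    using N by (auto simp: null_sets_def)
  finally have "AE x in lborel. (indicator N (x + a) :: ennreal) = 0"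
    by (subst (asm) nn_integral_0_iff_AE) auto
  then show ?thesis
    using N(2) by (auto simp: indicator_def elim!: eventually_mono)
qed

text \<open>For a fixed step, a difference involves only finitely many translates of the exceptional
  null set.\<close>

lemma Besov_seminorm_cong_AE:
  assumes ae: "AE x in lebesgue. f x = g x"
  shows "Besov_seminorm j k r p \<theta> f = Besov_seminorm j k r p \<theta> g"
proof -
  have "AE x in lborel. f x = g x"
    using ae by (subst (asm) AE_completion_iff)
  then have "AE x in lborel. \<forall>i\<in>{..k}. f (x + (real i * h) *\<^sub>R axis j 1) = g (x + (real i * h) *\<^sub>R axis j 1)" for h
    by (intro AE_finite_allI AE_translate) auto
  then have diff: "AE x in lborel. difference j k h f x = difference j k h g x" for h
    unfolding difference_def by (rule eventually_mono) (auto intro!: sum.cong)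
  have "(\<integral>\<^sup>+x. epowr (ennreal \<bar>difference j k h f x\<bar>) p \<partial>lborel)
      = (\<integral>\<^sup>+x. epowr (ennreal \<bar>difference j k h g x\<bar>) p \<partial>lborel)" for h
    by (rule nn_integral_cong_AE) (use diff[of h] in eventually_elim, simp)
  then have "Lp_norm p (difference j k h f) = Lp_norm p (difference j k h g)" for h
    by (simp only: Lp_norm_lborel)
  then show ?thesis
    by (simp add: Besov_seminorm_def)
qed

lemma Besov_seminorm_eq_dh_norm:
  "Besov_seminorm j k r p \<theta> f = dh_norm \<theta> (\<lambda>h. ennreal (h powr - r) * Lp_norm p (difference j k h f))"
  by (simp add: Besov_seminorm_def dh_norm_def)

text \<open>Almost everywhere \<open>f\<close> equals its restriction to a compact set, which is
  integrable and so has a Borel version. For a Borel function the differences are jointly measurable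
  in step and point.\<close>

lemma borel_representative:
  fixes f :: "'a::euclidean_space \<Rightarrow> real"
  assumes "locally_integrable f" "compactly_supported f"
  obtains g R where "g \<in> borel_measurable borel" "AE x in lebesgue. f x = g x"
    "(\<integral>\<^sup>+x. ennreal \<bar>g x\<bar> \<partial>lborel) < \<infinity>" "0 < R" "AE x in lborel. R < norm x \<longrightarrow> g x = 0"
proof -
  obtain K where K: "compact K" "AE x in lebesgue. x \<notin> K \<longrightarrow> f x = 0"
    using assms by (auto simp: compactly_supported_def)
  then have int: "integrable lebesgue (\<lambda>x. indicator K x *\<^sub>R f x)"
    using assms by (auto simp: locally_integrable_def set_integrable_def)
  then obtain g where g: "g \<in> borel_measurable lborel" "AE x in lborel. indicator K x *\<^sub>R f x = g x"
    using completion_ex_borel_measurable_real[of "\<lambda>x. indicator K x *\<^sub>R f x" lborel] by auto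
  have K': "AE x in lborel. x \<notin> K \<longrightarrow> f x = 0"
    using K(2) by (subst (asm) AE_completion_iff)
  have "AE x in lborel. f x = g x"
    using g(2) K' by eventually_elim (auto simp: indicator_def split: if_splits)
  then have fg: "AE x in lebesgue. f x = g x"
    by (subst AE_completion_iff)
  have "(\<integral>\<^sup>+x. ennreal \<bar>g x\<bar> \<partial>lborel) = (\<integral>\<^sup>+x. ennreal (norm (indicator K x *\<^sub>R f x)) \<partial>lborel)"
    using g(2) by (intro nn_integral_cong_AE) auto
  also have "\<dots> < \<infinity>"
    using int by (simp add: integrable_iff_bounded nn_integral_completion)
  finally have fin: "(\<integral>\<^sup>+x. ennreal \<bar>g x\<bar> \<partial>lborel) < \<infinity>" .
  obtain R where R: "0 < R" "K \<subseteq> cball 0 R"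
    using bounded_subset_ballD[OF compact_imp_bounded[OF K(1)], of 0] ball_subset_cball by blast
  have "AE x in lborel. R < norm x \<longrightarrow> g x = 0"
    using g(2)
  proof eventually_elim
    case (elim x)
    then show ?case
      using R(2) by (cases "x \<in> K") (auto simp: subset_iff)
  qed
  then show thesis
    using that g(1) fg fin R(1) by auto
qed

text \<open>For a step beyond \<open>2 * R\<close>, the shifts of a point of the ball of radius
  \<open>R\<close> leave that ball, so on the ball the difference is \<open>g\<close> up to sign
  almost everywhere.\<close>

lemma Lp_norm_difference_pos:
  fixes g :: "real^'n \<Rightarrow> real"
  assumes [measurable]: "g \<in> borel_measurable borel" and supp: "AE x in lborel. R < norm x \<longrightarrow> g x = 0"
    and nz: "\<not> (AE x in lborel. g x = 0)" and h: "2 * R < h" "0 < R"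
  shows "Lp_norm p (difference j k h g) \<noteq> 0"
proof
  assume "Lp_norm p (difference j k h g) = 0"
  then have "AE x in lborel. difference j k h g x = 0"
    unfolding Lp_norm_lborel by (simp add: nn_integral_0_iff_AE)
  moreover have "AE x in lborel. \<forall>i\<in>{1..k}. R < norm (x + (real i * h) *\<^sub>R axis j 1) \<longrightarrow> g (x + (real i * h) *\<^sub>R axis j 1) = 0"
    by (intro AE_finite_allI AE_translate[OF supp]) auto
  ultimately have "AE x in lborel. g x = 0"
    using supp
  proof eventually_elim
    case (elim x)
    show "g x = 0"
    proof (cases "R < norm x")
      case False
      have "g (x + (real i * h) *\<^sub>R axis j 1) = 0" if i: "i \<in> {1..k}" for i
      proof -
        have "1 * h \<le> real i * h"
          using i h by (intro mult_right_mono) auto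
        moreover have "norm ((real i * h) *\<^sub>R axis j (1::real)) \<le> norm (x + (real i * h) *\<^sub>R axis j 1) + norm x"
          using norm_triangle_ineq4[of "x + (real i * h) *\<^sub>R axis j 1" x] by simp
        moreover have "norm ((real i * h) *\<^sub>R axis j (1::real)) = real i * h"
          using h by simp
        ultimately have "R < norm (x + (real i * h) *\<^sub>R axis j 1)"
          using False h by linarith
        with elim i show ?thesis by blast
      qed
      then have "\<bar>g x\<bar> \<le> \<bar>difference j k h g x\<bar>"
        using abs_le_difference[of g x k h j] by simp
      with elim show ?thesis by simp
    qed (use elim in auto)
  qed
  with nz show False by simp
qed

text \<open>The interval from \<open>C\<close> to \<open>C + 1\<close> alone contributes a positive
  amount. This permits taking logarithms of the smoothings in the balancing.\<close>

lemma log_smooth_pos: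
  assumes [measurable]: "w \<in> borel_measurable borel" and pos: "\<And>u. C < u \<Longrightarrow> w u \<noteq> 0" and C: "0 < C"
  shows "log_smooth \<gamma> w v \<noteq> 0"
proof
  assume "log_smooth \<gamma> w v = 0"
  then have "AE u in lborel. w u * ennreal (exp (- \<gamma> * \<bar>ln u - v\<bar>) / u) * indicator {0<..} u = 0"
    unfolding log_smooth_def by (subst (asm) nn_integral_0_iff_AE) auto
  then have "AE u in lborel. u \<notin> {C<..<C + 1}"
  proof eventually_elim
    case (elim u)
    then show ?case
      using C pos[of u] by auto
  qed
  then have "emeasure lborel {C<..<C + 1} = 0"
    by (subst (asm) AE_iff_measurable[of "{C<..<C + 1}"]) auto
  then show False by simp
qed

text \<open>The balancing is applied to \<open>r j * x + ln (\<Psi> j x)\<close>, whose slopes lie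
  between \<open>r j * (1 - \<kappa>)\<close> and \<open>r j * (1 + \<kappa>)\<close>. The weights
  \<open>w j\<close> identify the shared level as the logarithm of a weighted geometric mean of the
  \<open>\<Psi> j\<close>.\<close>

lemma balanced_sequence:
  fixes r a w :: "'n::finite \<Rightarrow> real" and \<Psi> :: "'n \<Rightarrow> real \<Rightarrow> real"
  assumes r: "\<And>j. 0 < r j" and \<kappa>: "0 < \<kappa>" "\<kappa> < 1" and a: "\<And>j. 0 < a j" "(\<Sum>j\<in>UNIV. a j / r j) = 1"
    and \<eta>: "0 < \<eta>" "\<And>j. \<eta> \<le> a j / 2" "\<kappa> \<le> \<eta> * (\<Sum>j\<in>UNIV. 1 / r j)"
    and w: "\<And>j. w j = 1 / r j / (\<Sum>j\<in>UNIV. 1 / r j)"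
    and \<Psi>: "\<And>j x. 0 < \<Psi> j x" "\<And>j x y. \<Psi> j y \<le> exp (\<kappa> * r j * \<bar>x - y\<bar>) * \<Psi> j x"
    and B: "1 < B"
  obtains v :: "int \<Rightarrow> 'n \<Rightarrow> real" where
    "\<And>m. (\<Sum>j\<in>UNIV. v m j) = (real_of_int m + 1) * ln B"
    "\<And>m j. exp (r j * v m j) * \<Psi> j (v m j) = B powr ((real_of_int m + 1) * a j) * (\<Prod>i\<in>UNIV. \<Psi> i (v m i) powr w i)"
    "\<And>m m' j. m < m' \<Longrightarrow> a j / (2 * r j * (1 + \<kappa>)) * ln B \<le> v m' j - v m j"
proof -
  define G where "G j x = r j * x + ln (\<Psi> j x)" for j x
  have lip: "\<bar>ln (\<Psi> j y) - ln (\<Psi> j x)\<bar> \<le> \<kappa> * r j * \<bar>x - y\<bar>" for j x y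
  proof -
    have "ln (\<Psi> j y) \<le> \<kappa> * r j * \<bar>x - y\<bar> + ln (\<Psi> j x)" for x y
    proof -
      have "ln (\<Psi> j y) \<le> ln (exp (\<kappa> * r j * \<bar>x - y\<bar>) * \<Psi> j x)"
        using \<Psi> by (intro ln_mono) auto
      then show ?thesis
        using \<Psi>(1)[of j x] by (simp add: ln_mult)
    qed
    from this[of y x] this[of x y] show ?thesis
      by (simp add: abs_le_iff abs_minus_commute)
  qed
  have lo: "r j * (1 - \<kappa>) * (y - x) \<le> G j y - G j x" and up: "G j y - G j x \<le> r j * (1 + \<kappa>) * (y - x)"
    if "x \<le> y" for j x y
    using lip[of j y x] that by (auto simp: G_def abs_le_iff algebra_simps)
  define \<tau> where "\<tau> m = (real_of_int m + 1) * ln B" for m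
  have "\<exists>l v. (\<forall>j. G j (v j) = l + \<tau> m * a j) \<and> (\<Sum>j\<in>UNIV. v j) = \<tau> m" for m
    using r \<kappa> by (intro balance_exists[OF _ lo up]) auto
  then obtain l v where v: "\<And>m j. G j (v m j) = l m + \<tau> m * a j" "\<And>m. (\<Sum>j\<in>UNIV. v m j) = \<tau> m"
    by metis
  have R: "0 < (\<Sum>j\<in>UNIV. 1 / r j)" (is "0 < ?R")
    using r by (intro sum_pos) auto
  have w_r: "w j * r j = 1 / ?R" for j
    using r[of j] by (simp add: w)
  have "(\<Sum>j\<in>UNIV. w j) = ?R / ?R"
    unfolding w by (rule sum_divide_distrib[symmetric])
  then have w_sum: "(\<Sum>j\<in>UNIV. w j) = 1"
    using R by simp
  \<comment> \<open>In the average of the balance equations with weights \<open>w j\<close>, the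
    product \<open>w j * r j\<close> is constant and the \<open>w j * a j\<close> sum to
    \<open>1 / ?R\<close>. Hence the terms with \<open>\<tau> m\<close> cancel.\<close>
  have l: "l m = (\<Sum>j\<in>UNIV. w j * ln (\<Psi> j (v m j)))" for m
  proof -
    have "(\<Sum>j\<in>UNIV. w j * G j (v m j)) = (\<Sum>j\<in>UNIV. w j * r j * v m j) + (\<Sum>j\<in>UNIV. w j * ln (\<Psi> j (v m j)))"
      by (simp add: G_def distrib_left sum.distrib mult.assoc)
    also have "(\<Sum>j\<in>UNIV. w j * r j * v m j) = \<tau> m / ?R"
      by (simp add: w_r v(2) flip: sum_divide_distrib)
    finally have 1: "(\<Sum>j\<in>UNIV. w j * G j (v m j)) = \<tau> m / ?R + (\<Sum>j\<in>UNIV. w j * ln (\<Psi> j (v m j)))" .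
    have "w j * G j (v m j) = w j * l m + \<tau> m * (w j * a j)" for j
      by (simp add: v(1) algebra_simps)
    then have "(\<Sum>j\<in>UNIV. w j * G j (v m j)) = (\<Sum>j\<in>UNIV. w j) * l m + \<tau> m * (\<Sum>j\<in>UNIV. w j * a j)"
      by (simp only: sum.distrib sum_distrib_left[symmetric] sum_distrib_right[symmetric])
    also have "(\<Sum>j\<in>UNIV. w j * a j) = (\<Sum>j\<in>UNIV. a j / r j) / ?R"
      unfolding sum_divide_distrib by (intro sum.cong) (simp_all add: w)
    finally show ?thesis
      using 1 by (simp add: w_sum a)
  qed
  show thesis
  proof
    show "(\<Sum>j\<in>UNIV. v m j) = (real_of_int m + 1) * ln B" for m
      by (simp add: v \<tau>_def)
    show "exp (r j * v m j) * \<Psi> j (v m j) = B powr ((real_of_int m + 1) * a j) * (\<Prod>i\<in>UNIV. \<Psi> i (v m i) powr w i)" for m j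
    proof -
      have "exp (r j * v m j) * \<Psi> j (v m j) = exp (G j (v m j))"
        using \<Psi>(1) by (simp add: G_def exp_add)
      also have "\<dots> = exp (\<tau> m * a j) * exp (l m)"
        by (simp add: v exp_add)
      also have "exp (\<tau> m * a j) = B powr ((real_of_int m + 1) * a j)"
        using B by (simp add: powr_def \<tau>_def mult_ac)
      also have "exp (l m) = (\<Prod>i\<in>UNIV. \<Psi> i (v m i) powr w i)"
        using less_imp_neq[OF \<Psi>(1), symmetric] by (simp add: l exp_sum powr_def)
      finally show ?thesis .
    qed
    show "a j / (2 * r j * (1 + \<kappa>)) * ln B \<le> v m' j - v m j" if "m < m'" for m m' j
    proof -
      have ln: "1 * ln B \<le> (real_of_int m' - real_of_int m) * ln B"
        using that B by (intro mult_right_mono) auto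
      then have step: "ln B \<le> \<tau> m' - \<tau> m"
        by (simp add: \<tau>_def algebra_simps)
      then have less: "\<tau> m < \<tau> m'"
        using ln_gt_zero[OF B] by linarith
      have "a j / (2 * r j * (1 + \<kappa>)) * (\<tau> m' - \<tau> m) \<le> v m' j - v m j"
        by (rule balance_spread[where G = G and r = r and \<kappa> = \<kappa> and a = a and \<eta> = \<eta> and v = "v m" and l = "l m"
              and \<tau> = "\<tau> m" and v' = "v m'" and l' = "l m'" and \<tau>' = "\<tau> m'"])
          (fact r \<kappa> lo up a \<eta> v less)+
      moreover have "a j / (2 * r j * (1 + \<kappa>)) * ln B \<le> a j / (2 * r j * (1 + \<kappa>)) * (\<tau> m' - \<tau> m)"
        using a(1)[of j] r[of j] \<kappa> step by (intro mult_left_mono) auto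
      ultimately show ?thesis
        by linarith
    qed
  qed
qed

text \<open>Up to the factor \<open>B powr s\<close>, \<open>a m\<close> majorises the Lorentz
  integrand before its power is taken, on the block starting at \<open>B powr m\<close>. Absorption
  bounds \<open>a\<close> by the data for \<open>b\<close>, and passing from the sum to the integral
  costs at most another factor \<open>B\<close>.\<close>

lemma Lorentz_norm_le_of_recursion:
  fixes f g :: "'a::euclidean_space \<Rightarrow> real" and b :: "int \<Rightarrow> real"
  assumes fg: "AE x in lebesgue. f x = g x" and fin: "(\<integral>\<^sup>+x. ennreal \<bar>g x\<bar> \<partial>lborel) < \<infinity>"
    and B: "1 < B" and s: "0 < s" "s < 1" and q: "1 / q = s" and \<theta>: "1 \<le> \<theta>"
  defines "a m \<equiv> B powr (s * real_of_int m) * enn2real (avg_sup g (B powr m))"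
  assumes step: "\<And>m. a m \<le> a (m + 1) / 2 + b m / 2" and b: "\<And>m. 0 \<le> b m" "\<And>m. b m \<le> Y"
    and sum: "\<And>F. \<theta> \<noteq> \<infinity> \<Longrightarrow> finite F \<Longrightarrow> (\<Sum>m\<in>F. b m powr enn2real \<theta>) \<le> Y powr enn2real \<theta>"
  shows "Lorentz_norm q \<theta> f \<le> ennreal (B powr (1 + s) * Y)"
proof -
  obtain X where X: "(\<integral>\<^sup>+x. ennreal \<bar>g x\<bar> \<partial>lborel) = ennreal X" "0 \<le> X"
    using fin by (cases "\<integral>\<^sup>+x. ennreal \<bar>g x\<bar> \<partial>lborel") auto
  have avg: "avg_sup g (B powr z) \<le> ennreal (X * B powr - z)" for z
    using avg_sup_le[of "B powr z" g] B X by (simp add: divide_ennreal powr_minus_divide)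
  have avg_real: "avg_sup g (B powr z) = ennreal (enn2real (avg_sup g (B powr z)))" for z
  proof -
    have "avg_sup g (B powr z) \<noteq> top"
      using avg[of z] by (auto simp: top_unique)
    then show ?thesis
      by (simp add: less_top)
  qed
  have Y: "0 \<le> Y"
    using b[of 0] by simp
  have a0: "0 \<le> a m" for m
    by (simp add: a_def)
  \<comment> \<open>Since \<open>s < 1\<close>, integrability of \<open>g\<close> forces geometric
    decay for large \<open>m\<close>, hence the limit 0 needed for the absorption.\<close>
  have a_le: "a m \<le> X * (B powr (s - 1)) powr m" for m
  proof -
    have "enn2real (avg_sup g (B powr m)) \<le> X * B powr - m"
      using avg[of m] X by (intro enn2real_leI) auto
    then have "a m \<le> B powr (s * m) * (X * B powr - m)"
      unfolding a_def by (intro mult_left_mono) auto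
    also have "\<dots> = X * (B powr (s - 1)) powr m"
      by (simp add: powr_powr algebra_simps flip: powr_add)
    finally show ?thesis .
  qed
  have lim: "(\<lambda>i. a (int i)) \<longlonglongrightarrow> 0"
  proof (rule tendsto_sandwich[where f = "\<lambda>_. 0" and h = "\<lambda>i. X * (B powr (s - 1)) ^ i"])
    have "B powr (s - 1) < B powr 0"
      using B s by (intro powr_less_mono) auto
    then have "(\<lambda>i. X * (B powr (s - 1)) ^ i) \<longlonglongrightarrow> X * 0"
      using B by (intro tendsto_mult tendsto_const LIMSEQ_power_zero) auto
    then show "(\<lambda>i. X * (B powr (s - 1)) ^ i) \<longlonglongrightarrow> 0"
      by simp
    show "\<forall>\<^sub>F i in sequentially. a (int i) \<le> X * (B powr (s - 1)) ^ i"
      using a_le[of "int _"] B by (intro always_eventually allI) (simp add: powr_realpow)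
  qed (use a0 in auto)
  have level: "ennreal (t powr (1 / q)) * rearrangement f t \<le> ennreal (B powr s * a m)"
    if t: "B powr m \<le> t" "t < B powr (m + 1)" for m :: int and t
  proof -
    have "0 < B powr m"
      using B by simp
    then have t0: "0 < t"
      using t by linarith
    have "rearrangement f t \<le> avg_sup g t"
      by (rule rearrangement_le_avg_sup[OF fg t0])
    also have "\<dots> \<le> avg_sup g (B powr m)"
      by (rule avg_sup_antimono) (rule t)
    finally have R: "rearrangement f t \<le> ennreal (enn2real (avg_sup g (B powr m)))"
      by (simp flip: avg_real)
    have "t powr s \<le> (B powr (m + 1)) powr s"
      using t t0 s by (intro powr_mono2) auto
    also have "\<dots> = B powr s * B powr (s * m)"
      by (simp add: powr_powr algebra_simps flip: powr_add)
    finally have "ennreal (t powr s) * rearrangement f t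
      \<le> ennreal (B powr s * B powr (s * m)) * ennreal (enn2real (avg_sup g (B powr m)))"
      by (intro mult_mono ennreal_leI R) auto
    also have "\<dots> = ennreal (B powr s * a m)"
      unfolding a_def by (simp add: ennreal_mult mult.assoc)
    finally show ?thesis
      using q by simp
  qed
  show ?thesis
  proof (cases "\<theta> = \<infinity>")
    case True
    have "ennreal (t powr (1 / q)) * rearrangement f t \<le> ennreal (B powr (1 + s) * Y)" if t: "0 < t" for t
    proof -
      obtain m :: int where m: "B powr m \<le> t" "t < B powr (m + 1)"
        using geometric_level_exists[OF B t] by blast
      have "B powr s * a m \<le> B powr (1 + s) * Y"
        using sup_absorb[of a b Y m, OF step lim b(2) Y] a0 B s
        by (intro mult_mono powr_mono) auto
      with level[OF m] show ?thesis
        by (meson ennreal_leI order_trans)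
    qed
    then show ?thesis
      unfolding Lorentz_norm_def using True by (auto intro: SUP_least)
  next
    case False
    define s' where "s' = enn2real \<theta>"
    have s': "1 \<le> s'"
      using \<theta> False by (cases \<theta>) (auto simp: s'_def)
    have "(\<integral>\<^sup>+t\<in>{0<..}. epowr (ennreal (t powr (1 / q)) * rearrangement f t) s' * ennreal (1 / t) \<partial>lborel)
       \<le> ennreal (B * (B powr s * Y) powr s')"
    proof (rule nn_integral_dyadic_le[OF B])
      fix m :: int and t assume "B powr m \<le> t" "t < B powr (m + 1)"
      from level[OF this] have "epowr (ennreal (t powr (1 / q)) * rearrangement f t) s' \<le> epowr (ennreal (B powr s * a m)) s'"
        using s' by (intro epowr_mono) auto
      then show "epowr (ennreal (t powr (1 / q)) * rearrangement f t) s' \<le> ennreal ((B powr s * a m) powr s')"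
        using a0 by simp
    next
      fix M
      have "(\<Sum>m\<in>{- int M..int M}. a m powr s') \<le> Y powr s'"
        using sum[OF False] by (intro sum_powr_absorb[of a b s'] a0 b(1) step lim s') (simp add: s'_def)
      then have "(B powr s) powr s' * (\<Sum>m\<in>{- int M..int M}. a m powr s') \<le> (B powr s) powr s' * Y powr s'"
        by (intro mult_left_mono) auto
      then show "(\<Sum>m\<in>{- int M..int M}. (B powr s * a m) powr s') \<le> (B powr s * Y) powr s'"
        using a0 Y by (simp add: powr_mult sum_distrib_left)
    qed auto
    then have "Lorentz_norm q \<theta> f \<le> epowr (ennreal (B * (B powr s * Y) powr s')) (1 / s')"
      using False s' by (simp add: Lorentz_norm_def nn_integral_completion s'_def[symmetric] epowr_mono)
    also have "\<dots> = ennreal (B powr (1 / s') * (B powr s * Y))"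
      using B Y s' by (simp add: powr_mult powr_powr)
    also have "\<dots> \<le> ennreal (B powr (1 + s) * Y)"
    proof (rule ennreal_leI)
      have "B powr (1 / s') * (B powr s * Y) \<le> B powr 1 * (B powr s * Y)"
        using B s' Y by (intro mult_right_mono powr_mono) auto
      then show "B powr (1 / s') * (B powr s * Y) \<le> B powr (1 + s) * Y"
        using B by (simp add: powr_add)
    qed
    finally show ?thesis .
  qed
qed

abbreviation weighted_modulus :: "'n::finite \<Rightarrow> nat \<Rightarrow> real \<Rightarrow> real \<Rightarrow> (real^'n \<Rightarrow> real) \<Rightarrow> real \<Rightarrow> ennreal" where
  "weighted_modulus j k r p g \<equiv> \<lambda>h. ennreal (h powr - r) * Lp_norm p (difference j k h g)"

text \<open>The embedding for Borel functions with finite, nonzero seminorms. An infinite exponent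
  enters the Hoelder relation correctly because \<open>enn2real \<infinity>\<close> and
  \<open>1 / 0\<close> are both 0.\<close>

lemma Lorentz_norm_le_prod_dh_norm:
  fixes rs ps a w :: "'n::finite \<Rightarrow> real" and ks :: "'n \<Rightarrow> nat" and \<theta>s :: "'n \<Rightarrow> ennreal"
  assumes rs: "\<And>j. 0 < rs j" and ps: "\<And>j. 1 \<le> ps j" and \<theta>s: "\<And>j. 1 \<le> \<theta>s j"
    and s: "0 < s" "s < 1" and q: "1 / q = s"
    and a: "\<And>j. a j = 1 / ps j - s" "\<And>j. 0 < a j" "(\<Sum>j\<in>UNIV. a j / rs j) = 1"
    and w: "\<And>j. w j = 1 / rs j / (\<Sum>j\<in>UNIV. 1 / rs j)"
    and \<theta>: "1 \<le> \<theta>" "(\<Sum>j\<in>UNIV. w j * (1 / enn2real (\<theta>s j))) = 1 / enn2real \<theta>"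
  shows "\<exists>c>0. \<forall>(f :: real^'n \<Rightarrow> real) g N. (AE x in lebesgue. f x = g x) \<and> g \<in> borel_measurable borel \<and>
      (\<integral>\<^sup>+x. ennreal \<bar>g x\<bar> \<partial>lborel) < \<infinity> \<and>
      (\<forall>j. dh_norm (\<theta>s j) (weighted_modulus j (ks j) (rs j) (ps j) g) = ennreal (N j) \<and> 0 < N j) \<and>
      (\<forall>j \<gamma> x. log_smooth \<gamma> (weighted_modulus j (ks j) (rs j) (ps j) g) x \<noteq> 0)
      \<longrightarrow> Lorentz_norm q \<theta> f \<le> ennreal (c * (\<Prod>j\<in>UNIV. N j powr w j))"
proof -
  define n where "n = real CARD('n)"
  have n: "0 < n"
    by (simp add: n_def)
  define A where "A = (\<Prod>j\<in>(UNIV :: 'n set). 2 ^ ks j :: real)"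
  have A: "1 \<le> A"
    unfolding A_def by (intro prod_ge_1) auto
  \<comment> \<open>This gives \<open>A * B powr - s = 1 / 2\<close>, the factor with which the next
    level enters the recursion.\<close>
  define B where "B = (2 * A) powr (1 / s)"
  have B: "1 < B" "B powr s = 2 * A"
    using A s by (auto simp: B_def powr_powr)
  \<comment> \<open>\<open>\<eta>\<close> and then \<open>\<kappa>\<close> are taken small enough
    for \<open>balance_spread\<close>.\<close>
  define \<eta> where "\<eta> = Min (range a) / 2"
  have \<eta>: "0 < \<eta>" "\<And>j. \<eta> \<le> a j / 2"
    using a(2) by (auto simp: \<eta>_def)
  have R: "0 < (\<Sum>j\<in>UNIV. 1 / rs j)"
    using rs by (intro sum_pos) auto
  define \<kappa> where "\<kappa> = min (1 / 2) (\<eta> * (\<Sum>j\<in>UNIV. 1 / rs j))"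
  have \<kappa>: "0 < \<kappa>" "\<kappa> < 1" "\<kappa> \<le> \<eta> * (\<Sum>j\<in>UNIV. 1 / rs j)"
    using \<eta> R by (auto simp: \<kappa>_def)
  have w0: "0 < w j" for j
    using rs[of j] R by (simp add: w)
  \<comment> \<open>With this rate the logarithm of the \<open>j\<close>-th smoothing has Lipschitz
    constant \<open>\<kappa> * rs j\<close>.\<close>
  define \<gamma> where "\<gamma> j = \<kappa> * rs j" for j
  have \<gamma>: "0 < \<gamma> j" "\<gamma> j \<le> rs j + 1" for j
  proof -
    show "0 < \<gamma> j"
      using \<kappa> rs[of j] by (simp add: \<gamma>_def)
    have "\<kappa> * rs j \<le> 1 * rs j"
      using \<kappa> rs[of j] by (intro mult_right_mono) auto
    then show "\<gamma> j \<le> rs j + 1"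
      by (simp add: \<gamma>_def)
  qed
  define \<delta> where "\<delta> j = a j / (2 * rs j * (1 + \<kappa>)) * ln B" for j
  have \<delta>: "0 < \<delta> j" for j
    using a(2)[of j] rs[of j] \<kappa> B by (simp add: \<delta>_def)
  define Q where "Q j M \<longleftrightarrow> 0 < M \<and> (\<forall>W N. W \<in> borel_measurable borel \<and> dh_norm (\<theta>s j) W = ennreal N \<and> 0 \<le> N \<longrightarrow>
      (\<forall>x. log_smooth (\<gamma> j) W x \<le> ennreal (M * N)) \<and>
      (\<theta>s j \<noteq> \<infinity> \<longrightarrow> (\<forall>v F. (\<forall>m m'. m < m' \<longrightarrow> \<delta> j \<le> v m' - v m) \<and> finite (F :: int set) \<longrightarrow>
       (\<Sum>m\<in>F. epowr (log_smooth (\<gamma> j) W (v m)) (enn2real (\<theta>s j))) \<le> ennreal ((M * N) powr enn2real (\<theta>s j)))))"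
    for j M
  have "\<exists>M. Q j M" for j
    unfolding Q_def by (rule log_smooth_dh_norm[OF \<theta>s \<gamma>(1) \<delta>])
  then obtain M where Q: "\<And>j. Q j (M j)"
    by metis
  then have M: "\<And>j. 0 < M j"
    by (simp add: Q_def)
  have M_le: "(\<forall>x. log_smooth (\<gamma> j) W x \<le> ennreal (M j * N)) \<and>
      (\<theta>s j \<noteq> \<infinity> \<longrightarrow> (\<forall>v F. (\<forall>m m'. m < m' \<longrightarrow> \<delta> j \<le> v m' - v m) \<and> finite (F :: int set) \<longrightarrow>
       (\<Sum>m\<in>F. epowr (log_smooth (\<gamma> j) W (v m)) (enn2real (\<theta>s j))) \<le> ennreal ((M j * N) powr enn2real (\<theta>s j))))"
    if "W \<in> borel_measurable borel" "dh_norm (\<theta>s j) W = ennreal N" "0 \<le> N" for j W N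
    using Q[of j] that unfolding Q_def by blast
  define c where "c = B powr (1 + s) * (4 * A * n * B * (\<Prod>j\<in>UNIV. M j powr w j))"
  have c: "0 < c"
    unfolding c_def using A B n M by (intro mult_pos_pos prod_pos) (auto simp: less_imp_neq[symmetric])
  have main: "Lorentz_norm q \<theta> f \<le> ennreal (c * (\<Prod>j\<in>UNIV. N j powr w j))"
    if fg: "AE x in lebesgue. f x = g x" and [measurable]: "g \<in> borel_measurable borel"
      and fin: "(\<integral>\<^sup>+x. ennreal \<bar>g x\<bar> \<partial>lborel) < \<infinity>"
      and N: "\<And>j. dh_norm (\<theta>s j) (weighted_modulus j (ks j) (rs j) (ps j) g) = ennreal (N j)" "\<And>j. 0 < N j"
      and pos: "\<And>j \<gamma> x. log_smooth \<gamma> (weighted_modulus j (ks j) (rs j) (ps j) g) x \<noteq> 0"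
    for f g :: "real^'n \<Rightarrow> real" and N
  proof -
    define W where "W j = weighted_modulus j (ks j) (rs j) (ps j) g" for j
    have [measurable]: "W j \<in> borel_measurable borel" for j
      unfolding W_def by measurable
    note N = N[folded W_def]
    define \<Psi> where "\<Psi> j x = enn2real (log_smooth (\<gamma> j) (W j) x)" for j x
    have top: "log_smooth (\<gamma> j) (W j) x \<noteq> top" for j x
      using M_le[OF _ N(1) less_imp_le[OF N(2)], of j, THEN conjunct1, THEN spec, of x] by (auto simp: top_unique)
    have \<Psi>_eq: "log_smooth (\<gamma> j) (W j) x = ennreal (\<Psi> j x)" for j x
      using top[of j x] by (simp add: \<Psi>_def less_top)
    have \<Psi>_pos: "0 < \<Psi> j x" for j x
      using pos[of "\<gamma> j" j x] top[of j x] unfolding \<Psi>_def W_def[symmetric]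
      by (simp add: enn2real_positive_iff zero_less_iff_neq_zero less_top)
    have \<Psi>_le: "\<Psi> j x \<le> M j * N j" for j x
      using M_le[OF _ N(1) less_imp_le[OF N(2)], of j, THEN conjunct1, THEN spec, of x] M[of j] N(2)[of j]
      by (simp add: \<Psi>_eq)
    have \<Psi>_lip: "\<Psi> j y \<le> exp (\<kappa> * rs j * \<bar>x - y\<bar>) * \<Psi> j x" for j x y
    proof -
      have "ennreal (\<Psi> j y) \<le> ennreal (exp (\<gamma> j * \<bar>x - y\<bar>)) * ennreal (\<Psi> j x)"
        unfolding \<Psi>_eq[symmetric] by (rule log_smooth_lipschitz[OF \<gamma>(1)]) measurable
      also have "\<dots> = ennreal (exp (\<gamma> j * \<bar>x - y\<bar>) * \<Psi> j x)"
        using \<Psi>_pos[of j x] by (simp add: ennreal_mult)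
      finally show ?thesis
        using \<Psi>_pos[of j x] by (simp add: \<gamma>_def)
    qed
    obtain v where v: "\<And>m. (\<Sum>j\<in>UNIV. v m j) = (real_of_int m + 1) * ln B"
      "\<And>m j. exp (rs j * v m j) * \<Psi> j (v m j) = B powr ((real_of_int m + 1) * a j) * (\<Prod>i\<in>UNIV. \<Psi> i (v m i) powr w i)"
      "\<And>m m' j. m < m' \<Longrightarrow> a j / (2 * rs j * (1 + \<kappa>)) * ln B \<le> v m' j - v m j"
      using balanced_sequence[where r = rs and a = a and w = w and \<Psi> = \<Psi>,
          OF rs \<kappa>(1,2) a(2,3) \<eta> \<kappa>(3) w \<Psi>_pos \<Psi>_lip B(1)] by blast
    \<comment> \<open>The weighted geometric mean that balancing puts into every difference
      term.\<close>
    define \<mu> where "\<mu> m = (\<Prod>i\<in>UNIV. \<Psi> i (v m i) powr w i)" for m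
    have \<mu>: "0 < \<mu> m" for m
      unfolding \<mu>_def using less_imp_neq[OF \<Psi>_pos, symmetric] by (intro prod_pos) auto
    \<comment> \<open>Normalised to values in the range of \<open>sum_prod_powr_le\<close>, at most
      1.\<close>
    define y where "y j m = \<Psi> j (v m j) / (M j * N j)" for j m
    have MN: "0 < M j * N j" for j
      using M[of j] N(2)[of j] by simp
    have y: "0 < y j m" "y j m \<le> 1" for j m
      using \<Psi>_pos[of j "v m j"] \<Psi>_le[of j "v m j"] MN[of j] by (auto simp: y_def)
    define P where "P = (\<Prod>j\<in>UNIV. (M j * N j) powr w j)"
    have P: "0 < P"
      unfolding P_def using less_imp_neq[OF MN, symmetric] by (intro prod_pos) auto
    have \<mu>_eq: "\<mu> m = P * (\<Prod>j\<in>UNIV. y j m powr w j)" for m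
    proof -
      have "\<Psi> j (v m j) = (M j * N j) * y j m" for j
        using M[of j] N(2)[of j] by (simp add: y_def)
      then show ?thesis
        by (simp only: \<mu>_def P_def powr_mult prod.distrib)
    qed
    \<comment> \<open>Twice the error of the recursion, which contains
      \<open>b m / 2\<close>.\<close>
    define b where "b m = 4 * A * n * B * \<mu> m" for m
    define Y where "Y = 4 * A * n * B * P"
    have C0: "0 < 4 * A * n * B"
      using A B n by simp
    have Y0: "0 < Y"
      using C0 P by (simp add: Y_def)
    have b_eq: "b m = Y * (\<Prod>j\<in>UNIV. y j m powr w j)" for m
      by (simp add: b_def Y_def \<mu>_eq)
    have y_prod: "0 \<le> (\<Prod>j\<in>UNIV. y j m powr w j)" "(\<Prod>j\<in>UNIV. y j m powr w j) \<le> 1" for m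
    proof -
      have "y j m powr w j \<le> 1 powr w j" for j
        using y[of j m] w0[of j] by (intro powr_mono2) auto
      then show "(\<Prod>j\<in>UNIV. y j m powr w j) \<le> 1"
        by (intro prod_le_1) auto
    qed (auto intro: prod_nonneg)
    have "Lorentz_norm q \<theta> f \<le> ennreal (B powr (1 + s) * Y)"
    proof (rule Lorentz_norm_le_of_recursion[OF fg fin B(1) s q \<theta>(1), where b = b])
      fix m
      let ?avg = "\<lambda>m. enn2real (avg_sup g (B powr real_of_int m))"
      define h where "h j = exp (v m j)" for j
      have h: "0 < h j" for j
        by (simp add: h_def)
      have h_prod: "(\<Prod>j\<in>UNIV. h j) = B powr real_of_int (m + 1)"
        using B by (simp add: h_def v powr_def flip: exp_sum)
      have avg_fin: "avg_sup g (B powr real_of_int m) < top" for m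
        using avg_sup_le[of "B powr real_of_int m" g] fin B
        by (auto simp: ennreal_divide_eq_top_iff less_top[symmetric] top_unique)
      \<comment> \<open>After balancing, \<open>1 / ps j = s + a j\<close> reduces the exponent of
        \<open>B\<close> to \<open>a j - s * m\<close>. Then \<open>a j \<le> 1\<close> gives a
        bound that is the same for all directions.\<close>
      have term_le: "ennreal (2 * (B powr m) powr (- 1 / ps j) / h j) *
           (\<integral>\<^sup>+u\<in>{0<..<h j}. Lp_norm (ps j) (difference j (ks j) u g) \<partial>lborel)
         \<le> ennreal (2 * B * B powr (- s * m) * \<mu> m)" for j
      proof -
        have "(\<integral>\<^sup>+u\<in>{0<..<h j}. Lp_norm (ps j) (difference j (ks j) u g) \<partial>lborel)
          = (\<integral>\<^sup>+u\<in>{0<..<h j}. ennreal (u powr rs j) * W j u \<partial>lborel)"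
        proof (rule nn_integral_cong)
          fix u
          show "Lp_norm (ps j) (difference j (ks j) u g) * indicator {0<..<h j} u
             = ennreal (u powr rs j) * W j u * indicator {0<..<h j} u"
          proof (cases "0 < u")
            case True
            then have "ennreal (u powr rs j) * ennreal (u powr - rs j) = 1"
              by (simp flip: ennreal_mult powr_add)
            then show ?thesis
              by (simp add: W_def mult.assoc[symmetric])
          qed simp
        qed
        then have "ennreal (1 / h j) * (\<integral>\<^sup>+u\<in>{0<..<h j}. Lp_norm (ps j) (difference j (ks j) u g) \<partial>lborel)
          \<le> ennreal (h j powr rs j) * log_smooth (\<gamma> j) (W j) (ln (h j))"
          using average_le_log_smooth[OF \<gamma> h, of "W j" j] by simp
        also have "\<dots> = ennreal (exp (rs j * v m j) * \<Psi> j (v m j))"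
          using \<Psi>_pos by (simp add: \<Psi>_eq h_def powr_def ennreal_mult less_imp_le)
        also have "\<dots> = ennreal (B powr ((real_of_int m + 1) * a j) * \<mu> m)"
          by (simp add: v(2) \<mu>_def)
        finally have "ennreal (2 * (B powr m) powr (- 1 / ps j)) *
            (ennreal (1 / h j) * (\<integral>\<^sup>+u\<in>{0<..<h j}. Lp_norm (ps j) (difference j (ks j) u g) \<partial>lborel))
          \<le> ennreal (2 * (B powr m) powr (- 1 / ps j)) * ennreal (B powr ((real_of_int m + 1) * a j) * \<mu> m)"
          by (intro mult_left_mono) auto
        also have "\<dots> = ennreal (2 * ((B powr m) powr (- 1 / ps j) * B powr ((real_of_int m + 1) * a j)) * \<mu> m)"
          using \<mu>[of m] by (simp add: mult_ac flip: ennreal_mult)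
        also have "\<dots> \<le> ennreal (2 * (B * B powr (- s * m)) * \<mu> m)"
        proof (intro ennreal_leI mult_right_mono mult_left_mono)
          have ps_a: "- 1 / ps j = - s - a j"
            by (simp add: a)
          have "(B powr m) powr (- 1 / ps j) * B powr ((real_of_int m + 1) * a j) = B powr (a j + - s * m)"
            unfolding ps_a by (simp add: powr_powr algebra_simps flip: powr_add)
          also have "\<dots> \<le> B powr (1 + - s * m)"
          proof -
            have "1 / ps j \<le> 1"
              using ps[of j] by simp
            then show ?thesis
              using B s a(1)[of j] by (intro powr_mono) auto
          qed
          also have "\<dots> = B * B powr (- s * m)"
            using B by (subst powr_add) simp
          finally show "(B powr m) powr (- 1 / ps j) * B powr ((real_of_int m + 1) * a j) \<le> B * B powr (- s * m)" .
        qed (use \<mu>[of m] in auto)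
        finally show ?thesis
          using h[of j] by (simp add: mult.assoc[symmetric] flip: ennreal_mult)
      qed
      have "avg_sup g (B powr m) \<le> ennreal A * (avg_sup g (B powr (m + 1)) +
          (\<Sum>j\<in>(UNIV::'n set). ennreal (2 * B * B powr (- s * m) * \<mu> m)))"
      proof -
        have "avg_sup g (B powr m) \<le> ennreal A * (avg_sup g (B powr (m + 1)) +
           (\<Sum>j\<in>UNIV. ennreal (2 * (B powr m) powr (- 1 / ps j) / h j) *
             (\<integral>\<^sup>+u\<in>{0<..<h j}. Lp_norm (ps j) (difference j (ks j) u g) \<partial>lborel)))"
          unfolding A_def h_prod[symmetric] using B ps h by (intro avg_sup_le_differences) auto
        also have "\<dots> \<le> ennreal A * (avg_sup g (B powr (m + 1)) +
          (\<Sum>j\<in>(UNIV::'n set). ennreal (2 * B * B powr (- s * m) * \<mu> m)))"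
          by (intro mult_left_mono add_left_mono sum_mono term_le) auto
        finally show ?thesis .
      qed
      also have "\<dots> = ennreal (A * (?avg (m + 1) + n * (2 * B * B powr (- s * m) * \<mu> m)))"
      proof -
        have "(\<Sum>j\<in>(UNIV::'n set). ennreal (2 * B * B powr (- s * m) * \<mu> m)) = ennreal (n * (2 * B * B powr (- s * m) * \<mu> m))"
          using B \<mu>[of m] by (subst sum_ennreal) (auto simp: n_def)
        moreover obtain x where "avg_sup g (B powr real_of_int (m + 1)) = ennreal x" "0 \<le> x"
          using avg_fin[of "m + 1"] by (cases "avg_sup g (B powr real_of_int (m + 1))") auto
        moreover have "0 \<le> n * (2 * B * B powr (- s * m) * \<mu> m)"
          using B n \<mu>[of m] by simp
        ultimately show ?thesis
          using A by (simp only: enn2real_ennreal) (simp flip: ennreal_mult ennreal_plus)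
      qed
      finally have "enn2real (avg_sup g (B powr m)) \<le> A * (?avg (m + 1) + n * (2 * B * B powr (- s * m) * \<mu> m))"
        using A B n \<mu>[of m] by (intro enn2real_leI) auto
      then have "B powr (s * m) * ?avg m \<le> B powr (s * m) * (A * (?avg (m + 1) + n * (2 * B * B powr (- s * m) * \<mu> m)))"
        by (intro mult_left_mono) auto
      also have "\<dots> = A * B powr (s * m) * ?avg (m + 1) + 2 * A * n * B * (B powr (s * m) * B powr (- s * m)) * \<mu> m"
        by (simp add: algebra_simps)
      also have "B powr (s * m) * B powr (- s * m) = 1"
        using B by (simp flip: powr_add)
      also have "A * B powr (s * m) = B powr (s * real_of_int (m + 1)) / 2"
        using B by (simp add: distrib_left powr_add)
      finally show "B powr (s * m) * ?avg m \<le> B powr (s * real_of_int (m + 1)) * ?avg (m + 1) / 2 + b m / 2"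
        by (simp add: b_def mult_ac)
    next
      fix m
      show "0 \<le> b m" "b m \<le> Y"
        using Y0 y_prod[of m] unfolding b_eq by (auto simp: mult_left_le)
    next
      fix F :: "int set" assume "\<theta> \<noteq> \<infinity>" and F: "finite F"
      then have \<theta>1: "1 \<le> enn2real \<theta>"
        using \<theta>(1) by (cases \<theta>) auto
      have "(\<Sum>m\<in>F. (\<Prod>j\<in>UNIV. y j m powr w j) powr enn2real \<theta>) \<le> 1"
      proof (rule sum_prod_powr_le[where i = "\<lambda>j. 1 / enn2real (\<theta>s j)"])
        fix j assume i: "1 / enn2real (\<theta>s j) \<noteq> 0"
        then have fin\<theta>: "\<theta>s j \<noteq> \<infinity>"
          by auto
        let ?t = "enn2real (\<theta>s j)"
        have "(\<Sum>m\<in>F. epowr (log_smooth (\<gamma> j) (W j) (v m j)) ?t) \<le> ennreal ((M j * N j) powr ?t)"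
          using v(3) F fin\<theta>
          by (intro M_le[OF _ N(1) less_imp_le[OF N(2)], of j, THEN conjunct2, rule_format]) (auto simp: \<delta>_def)
        also have "(\<Sum>m\<in>F. epowr (log_smooth (\<gamma> j) (W j) (v m j)) ?t) = ennreal (\<Sum>m\<in>F. \<Psi> j (v m j) powr ?t)"
          using \<Psi>_pos by (simp add: \<Psi>_eq less_imp_le)
        finally have "(\<Sum>m\<in>F. \<Psi> j (v m j) powr ?t) \<le> (M j * N j) powr ?t"
          by simp
        moreover have "0 < (M j * N j) powr ?t"
          using M[of j] N(2)[of j] by simp
        ultimately have "(\<Sum>m\<in>F. \<Psi> j (v m j) powr ?t) / (M j * N j) powr ?t \<le> 1"
          by (simp only: divide_le_eq_1_pos)
        then show "(\<Sum>m\<in>F. y j m powr (1 / (1 / ?t))) \<le> 1"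
          using \<Psi>_pos M[of j] N(2)[of j] by (simp add: y_def powr_divide less_imp_le sum_divide_distrib)
      qed (use y w0 \<theta> \<theta>1 in \<open>auto simp: less_imp_le\<close>)
      then have "Y powr enn2real \<theta> * (\<Sum>m\<in>F. (\<Prod>j\<in>UNIV. y j m powr w j) powr enn2real \<theta>) \<le> Y powr enn2real \<theta> * 1"
        by (intro mult_left_mono) auto
      then show "(\<Sum>m\<in>F. b m powr enn2real \<theta>) \<le> Y powr enn2real \<theta>"
        by (simp add: b_eq powr_mult sum_distrib_left)
    qed
    also have "B powr (1 + s) * Y = c * (\<Prod>j\<in>UNIV. N j powr w j)"
      by (simp add: c_def Y_def P_def powr_mult prod.distrib)
    finally show ?thesis .
  qed
  show ?thesis
    using c main by blast
qed

theorem theorem2: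
  fixes rs ps :: "'n::finite \<Rightarrow> real" and \<theta>s :: "'n \<Rightarrow> ennreal" and ks :: "'n \<Rightarrow> nat"
    and n r p q :: real and \<theta> :: ennreal and \<beta> :: "'n \<Rightarrow> real"
  assumes rs: "\<And>j. 0 < rs j" and ps: "\<And>j. 1 \<le> ps j" and \<theta>s: "\<And>j. 1 \<le> \<theta>s j"
    and ks: "\<And>j. rs j < real (ks j)"
    and n: "n = real CARD('n)"
    and r: "r = n / (\<Sum>j\<in>UNIV. 1 / rs j)"
    and p: "p = (n / r) / (\<Sum>j\<in>UNIV. 1 / (ps j * rs j))"
    and \<theta>: "\<theta> = ennreal (n / r) / (\<Sum>j\<in>UNIV. 1 / (\<theta>s j * ennreal (rs j)))"
    and \<beta>: "\<And>j. \<beta> j = 1 / rs j * (r / n + 1 / ps j - 1 / p)"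
    and \<beta>_pos: "\<And>j. 0 < \<beta> j"
    and p_less: "p < n / r"
    and q: "q = n * p / (n - r * p)"
  shows "\<exists>c>0. \<forall>f :: real^'n \<Rightarrow> real. locally_integrable f \<and> compactly_supported f \<longrightarrow>
           Lorentz_norm q \<theta> f
             \<le> ennreal c * (\<Prod>j\<in>UNIV. epowr (Besov_seminorm j (ks j) (rs j) (ps j) (\<theta>s j) f)
                                          (r / (n * rs j)))"
proof -
  let ?R = "\<Sum>j\<in>UNIV. 1 / rs j"
  have R: "0 < ?R"
    using rs by (intro sum_pos) auto
  have n0: "0 < n"
    by (simp add: n)
  have r0: "0 < r"
    using R n0 by (simp add: r)
  have n_r: "n / r = ?R"
    using R n0 by (simp add: r)
  define w where "w j = 1 / rs j / ?R" for j
  \<comment> \<open>The Hoelder weights are the exponents of the product in the claim.\<close>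
  have w_r: "w j = r / (n * rs j)" for j
    unfolding w_def n_r[symmetric] using r0 n0 by (simp add: field_simps)
  have w0: "0 < w j" for j
    using rs[of j] R by (simp add: w_def)
  have w_sum: "(\<Sum>j\<in>UNIV. w j) = 1"
  proof -
    have "(\<Sum>j\<in>UNIV. w j) = ?R / ?R"
      unfolding w_def by (rule sum_divide_distrib[symmetric])
    then show ?thesis
      using R by simp
  qed
  let ?S = "\<Sum>j\<in>UNIV. 1 / (ps j * rs j)"
  have ps0: "0 < ps j" for j
    using ps[of j] by simp
  have S0: "0 < ?S"
    using rs ps0 by (intro sum_pos) auto
  have p0: "0 < p"
    using S0 R by (simp add: p n_r)
  have inv_p: "1 / p = ?S / ?R"
    by (simp add: p n_r)
  have S_le: "?S \<le> ?R"
  proof (rule sum_mono)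
    fix j
    have "1 * rs j \<le> ps j * rs j"
      using ps[of j] rs[of j] by (intro mult_right_mono) auto
    then show "1 / (ps j * rs j) \<le> 1 / rs j"
      using rs[of j] by (intro divide_left_mono) auto
  qed
  define s where "s = 1 / p - r / n"
  have rn: "r / n = 1 / ?R"
    using n_r r0 n0 by (simp add: field_simps)
  have np: "0 < n - r * p"
    using p_less r0 by (simp add: field_simps)
  have q_s: "1 / q = s"
    using np p0 n0 by (simp add: q s_def field_simps)
  have s: "0 < s" "s < 1"
  proof -
    show "0 < s"
      unfolding q_s[symmetric] q using np p0 n0 by simp
    have "?S / ?R \<le> 1"
      using S_le R by simp
    moreover have "0 < r / n"
      using r0 n0 by simp
    ultimately show "s < 1"
      unfolding s_def inv_p by linarith
  qed
  define a where "a j = 1 / ps j - s" for j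
  \<comment> \<open>Thus positivity of \<open>\<beta> j\<close> is what makes the side lengths grow
    geometrically along the progression.\<close>
  have a_\<beta>: "a j = rs j * \<beta> j" for j
    using rs[of j] by (simp add: a_def s_def \<beta>)
  have a0: "0 < a j" for j
    using rs[of j] \<beta>_pos[of j] by (simp add: a_\<beta>)
  have a_sum: "(\<Sum>j\<in>UNIV. a j / rs j) = 1"
  proof -
    have "(\<Sum>j\<in>UNIV. a j / rs j) = (\<Sum>j\<in>UNIV. 1 / (ps j * rs j) - s * (1 / rs j))"
      by (intro sum.cong) (auto simp: a_def diff_divide_distrib)
    also have "\<dots> = ?S - s * ?R"
      by (simp add: sum_subtractf sum_distrib_left)
    also have "\<dots> = 1"
      using R by (simp add: s_def inv_p rn left_diff_distrib)
    finally show ?thesis .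
  qed
  define i where "i j = 1 / enn2real (\<theta>s j)" for j
  have i: "0 \<le> i j" "i j \<le> 1" "1 / (\<theta>s j * ennreal (rs j)) = ennreal (i j / rs j)" for j
  proof -
    show "0 \<le> i j"
      by (simp add: i_def)
    show "i j \<le> 1"
    proof (cases "\<theta>s j")
      case (real x)
      then show ?thesis
        using \<theta>s[of j] by (simp add: i_def)
    qed (simp add: i_def)
    show "1 / (\<theta>s j * ennreal (rs j)) = ennreal (i j / rs j)"
    proof (cases "\<theta>s j")
      case (real x)
      then have "1 \<le> x"
        using \<theta>s[of j] by simp
      then have "1 / (\<theta>s j * ennreal (rs j)) = ennreal 1 / ennreal (x * rs j)"
        using real rs[of j] by (simp add: ennreal_mult)
      also have "\<dots> = ennreal (1 / (x * rs j))"
        using \<open>1 \<le> x\<close> rs[of j] by (intro divide_ennreal) auto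
      finally show ?thesis
        using real by (simp add: i_def)
    next
      case top
      then show ?thesis
        using rs[of j] by (simp add: i_def ennreal_top_mult)
    qed
  qed
  let ?T = "\<Sum>j\<in>UNIV. i j / rs j"
  have T0: "0 \<le> ?T"
    using i rs by (intro sum_nonneg) (simp add: less_imp_le)
  \<comment> \<open>\<open>?T = 0\<close> occurs exactly when all \<open>\<theta>s j\<close> are
    infinite; the quotient in \<open>ennreal\<close> is then \<open>\<infinity>\<close>, as
    intended.\<close>
  have \<theta>_T: "\<theta> = ennreal ?R / ennreal ?T"
    using i rs by (simp add: \<theta> n_r less_imp_le)
  have T_le: "?T \<le> ?R"
    using i rs by (intro sum_mono divide_right_mono) (auto simp: less_imp_le)
  have wi: "(\<Sum>j\<in>UNIV. w j * i j) = ?T / ?R"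
    unfolding sum_divide_distrib by (intro sum.cong) (simp_all add: w_def)
  have \<theta>1: "1 \<le> \<theta>" and \<theta>i: "(\<Sum>j\<in>UNIV. w j * i j) = 1 / enn2real \<theta>"
  proof -
    have "1 \<le> \<theta> \<and> (\<Sum>j\<in>UNIV. w j * i j) = 1 / enn2real \<theta>"
    proof (cases "?T = 0")
      case True
      have "\<theta> = top"
        unfolding \<theta>_T True using R by simp
      with True show ?thesis
        unfolding wi by simp
    next
      case False
      with T0 have T: "0 < ?T"
        by linarith
      have "\<theta> = ennreal (?R / ?T)"
        unfolding \<theta>_T using R T by (simp add: divide_ennreal)
      moreover have "1 \<le> ?R / ?T"
        using T T_le by simp
      ultimately show ?thesis
        unfolding wi by simp
    qed
    then show "1 \<le> \<theta>" "(\<Sum>j\<in>UNIV. w j * i j) = 1 / enn2real \<theta>"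
      by auto
  qed
  obtain c where c: "0 < c" and main: "\<And>(f :: real^'n \<Rightarrow> real) g N. AE x in lebesgue. f x = g x \<Longrightarrow>
      g \<in> borel_measurable borel \<Longrightarrow> (\<integral>\<^sup>+x. ennreal \<bar>g x\<bar> \<partial>lborel) < \<infinity> \<Longrightarrow>
      (\<And>j. dh_norm (\<theta>s j) (weighted_modulus j (ks j) (rs j) (ps j) g) = ennreal (N j) \<and> 0 < N j) \<Longrightarrow>
      (\<And>j \<gamma> x. log_smooth \<gamma> (weighted_modulus j (ks j) (rs j) (ps j) g) x \<noteq> 0) \<Longrightarrow>
      Lorentz_norm q \<theta> f \<le> ennreal (c * (\<Prod>j\<in>UNIV. N j powr w j))"
    using Lorentz_norm_le_prod_dh_norm[of rs ps \<theta>s s q a w \<theta> ks, OF rs ps \<theta>s s q_s a_def a0 a_sum w_def \<theta>1 \<theta>i[unfolded i_def]]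
    by blast
  show ?thesis
  proof (intro exI[of _ c] conjI c allI impI)
    fix f :: "real^'n \<Rightarrow> real"
    assume "locally_integrable f \<and> compactly_supported f"
    then obtain g \<rho> where [measurable]: "g \<in> borel_measurable borel" and fg: "AE x in lebesgue. f x = g x"
      and fin: "(\<integral>\<^sup>+x. ennreal \<bar>g x\<bar> \<partial>lborel) < \<infinity>" and supp: "0 < \<rho>" "AE x in lborel. \<rho> < norm x \<longrightarrow> g x = 0"
      using borel_representative by blast
    define W where "W j = weighted_modulus j (ks j) (rs j) (ps j) g" for j
    have [measurable]: "W j \<in> borel_measurable borel" for j
      unfolding W_def by measurable
    have bes: "Besov_seminorm j (ks j) (rs j) (ps j) (\<theta>s j) f = dh_norm (\<theta>s j) (W j)" for j
      unfolding Besov_seminorm_cong_AE[OF fg] unfolding Besov_seminorm_eq_dh_norm W_def by (rule refl)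
    show "Lorentz_norm q \<theta> f
             \<le> ennreal c * (\<Prod>j\<in>UNIV. epowr (Besov_seminorm j (ks j) (rs j) (ps j) (\<theta>s j) f) (r / (n * rs j)))"
    \<comment> \<open>For a null function the smoothings vanish and have no logarithm, but then the
      Lorentz norm is 0.\<close>
    proof (cases "AE x in lborel. g x = 0")
      case True
      then have "(\<integral>\<^sup>+x. ennreal \<bar>g x\<bar> \<partial>lborel) = 0"
        by (subst nn_integral_0_iff_AE) auto
      then have "rearrangement f t = 0" if "0 < t" for t
        using rearrangement_le_avg_sup[OF fg that] avg_sup_le[OF that, of g] by simp
      then have zero: "ennreal (t powr (1 / q)) * rearrangement f t = 0" if "t \<in> {0<..}" for t
        using that by simp
      have "Lorentz_norm q \<theta> f = 0"
      proof (cases "\<theta> = \<infinity>")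
        case False
        have "(\<integral>\<^sup>+t\<in>{0<..}. epowr (ennreal (t powr (1 / q)) * rearrangement f t) (enn2real \<theta>) * ennreal (1 / t) \<partial>lebesgue)
           = (\<integral>\<^sup>+t. 0 \<partial>(lebesgue :: real measure))"
          by (intro nn_integral_cong) (auto simp: zero simp del: mult_eq_0_iff split: split_indicator)
        then show ?thesis
          using False by (simp add: Lorentz_norm_def)
      qed (simp add: Lorentz_norm_def zero)
      then show ?thesis by simp
    next
      case nz: False
      have pos: "log_smooth \<gamma> (W j) x \<noteq> 0" for j \<gamma> x
      proof (rule log_smooth_pos[where C = "2 * \<rho>"])
        fix u assume "2 * \<rho> < u"
        then show "W j u \<noteq> 0"
          unfolding W_def using Lp_norm_difference_pos[OF _ supp(2) nz, of u "ps j" j "ks j"] supp(1) by simp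
      qed (use supp in auto)
      \<comment> \<open>By the uniform bound with \<open>N = 0\<close>, a vanishing seminorm would
        make the smoothing vanish.\<close>
      have nonzero: "dh_norm (\<theta>s j) (W j) \<noteq> 0" for j
      proof
        assume "dh_norm (\<theta>s j) (W j) = 0"
        moreover obtain M where "\<And>w N. w \<in> borel_measurable borel \<and> dh_norm (\<theta>s j) w = ennreal N \<and> 0 \<le> N
            \<Longrightarrow> \<forall>x. log_smooth 1 w x \<le> ennreal (M * N)"
          using log_smooth_dh_norm[OF \<theta>s zero_less_one zero_less_one, of j] by blast
        from this[of "W j" 0] calculation have "log_smooth 1 (W j) 0 \<le> ennreal 0"
          by simp
        with pos[of 1 j 0] show False by simp
      qed
      show ?thesis
      \<comment> \<open>One infinite seminorm makes the product infinite because no factor is 0; in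
        \<open>ennreal\<close> the product of 0 and \<open>\<infinity>\<close> is 0.\<close>
      proof (cases "\<exists>j. dh_norm (\<theta>s j) (W j) = top")
        case True
        then obtain j0 where "dh_norm (\<theta>s j0) (W j0) = top"
          by blast
        then have "(\<Prod>j\<in>UNIV. epowr (dh_norm (\<theta>s j) (W j)) (r / (n * rs j))) = top"
          using nonzero by (subst ennreal_prod_eq_top) (auto intro!: exI[of _ j0])
        then show ?thesis
          using c by (simp add: bes ennreal_mult_top)
      next
        case False
        define N where "N j = enn2real (dh_norm (\<theta>s j) (W j))" for j
        have N: "dh_norm (\<theta>s j) (W j) = ennreal (N j)" for j
          using False by (simp add: N_def less_top)
        have N0: "0 < N j" for j
          using nonzero[of j] unfolding N by (simp add: ennreal_eq_0_iff)
        have "Lorentz_norm q \<theta> f \<le> ennreal (c * (\<Prod>j\<in>UNIV. N j powr w j))"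
          using N N0 pos by (intro main[OF fg _ fin]) (auto simp: W_def)
        also have "\<dots> = ennreal c * (\<Prod>j\<in>UNIV. ennreal (N j powr w j))"
          using c by (simp add: ennreal_mult prod_nonneg prod_ennreal)
        finally show ?thesis
          using N0 by (simp add: bes N w_r less_imp_le)
      qed
    qed
  qed
qed

end
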